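(* Let $w$ be an integer with $w-1\equiv1$ or $3\pmod6$, let $k$ be the largest integer such that $2^k$ divides $w$, and let $i\in\{0,\ldots,k\}$. Then the total number of different STS$(w-1)$ on $\{1,\ldots,w-1\}$ of $2$-rank $w-i-1$ equals $$\dot\Gamma_{w,0,i}\sum_{j=i}^k\dot\Gamma_{w,i,j}\,\mu^{(2)}_{j-i}\,\dot\Phi_{w-1,j},$$ where $\mu^{(2)}_l=(-1)^l2^{\binom l2}$, $\dot\Phi_{w-1,j}=\Psi_{w/2^j-1}\,\Pi_{w/2^j-1}^{\,2^j-1}\,\Lambda_{w/2^j}^{\,(2^j-1)(2^j-2)/6}$, $$\dot\Gamma_{w,i,j}=\left(\left(\tfrac{w}{2^i}\right)!\right)^{2^i}\Bigg/\left(2^{\frac{(j-i)(j+i+1)}2}\left(\left(\tfrac{w}{2^j}\right)!\right)^{2^j}\prod_{s=1}^{j-i}(2^s-1)\right),$$ $\Psi_u$ is the number of STS$(u)$ on $\{1,\ldots,u\}$, $\Pi_u$ is the number of symmetric latin squares of order $u$, and $\Lambda_u$ is the number of latin squares of order $u$.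
   Context: A Steiner triple system STS$(n)$ on $\{1,\ldots,n\}$ is a collection of 3-subsets (blocks) such that every 2-subset is contained in exactly one block; systems are different when their block sets differ. The $2$-rank of an STS is the dimension of the $\mathrm{GF}(2)$-span of the characteristic vectors of its blocks in $\mathrm{GF}(2)^n$. A latin square of order $u$ is a function $f:\{1,\ldots,u\}^2\to\{1,\ldots,u\}$ bijective in each argument; it is symmetric if $f(x,y)=f(y,x)$. Conventions: $\Psi_0=\Pi_0=1$, $\Psi_1=1$, and $\Psi_u=0$ if no STS$(u)$ exists. *)

theory Defs
  imports Complex_Main "HOL-Library.Z2" "HOL-Library.Function_Algebras"
    "HOL-Computational_Algebra.Primes"
begin

definition is_STS :: "nat \<Rightarrow> nat set set \<Rightarrow> bool" where
  "is_STS n B \<longleftrightarrow>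
     (\<forall>b\<in>B. b \<subseteq> {1..n} \<and> card b = 3) \<and>
     (\<forall>p. p \<subseteq> {1..n} \<and> card p = 2 \<longrightarrow> (\<exists>!b. b \<in> B \<and> p \<subseteq> b))"

text \<open>Vectors of GF(2)^n are represented as functions nat => bit supported in {1..n};
  scalar multiplication is pointwise.\<close>
definition gf2_scale :: "bit \<Rightarrow> (nat \<Rightarrow> bit) \<Rightarrow> (nat \<Rightarrow> bit)" where
  "gf2_scale c v = (\<lambda>x. c * v x)"

definition char_vec :: "nat set \<Rightarrow> (nat \<Rightarrow> bit)" where
  "char_vec b = (\<lambda>x. if x \<in> b then 1 else 0)"

definition rank2 :: "nat set set \<Rightarrow> nat" where
  "rank2 B = vector_space.dim gf2_scale (char_vec ` B)"

definition Psi :: "nat \<Rightarrow> nat" where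
  "Psi u = card {B. is_STS u B}"

definition latin_squares :: "nat \<Rightarrow> (nat \<Rightarrow> nat \<Rightarrow> nat) set" where
  "latin_squares u = {f.
     (\<forall>x y. x \<notin> {1..u} \<or> y \<notin> {1..u} \<longrightarrow> f x y = 0) \<and>
     (\<forall>x\<in>{1..u}. bij_betw (f x) {1..u} {1..u}) \<and>
     (\<forall>y\<in>{1..u}. bij_betw (\<lambda>x. f x y) {1..u} {1..u})}"

definition Lambda :: "nat \<Rightarrow> nat" where
  "Lambda u = card (latin_squares u)"

definition Pi :: "nat \<Rightarrow> nat" where
  "Pi u = card {f \<in> latin_squares u. \<forall>x y. f x y = f y x}"

definition mu2 :: "nat \<Rightarrow> real" where
  "mu2 l = (-1) ^ l * 2 ^ (l choose 2)"

definition PhiDot :: "nat \<Rightarrow> nat \<Rightarrow> real" where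
  "PhiDot w j = real (Psi (w div 2 ^ j - 1) * Pi (w div 2 ^ j - 1) ^ (2 ^ j - 1)
      * Lambda (w div 2 ^ j) ^ ((2 ^ j - 1) * (2 ^ j - 2) div 6))"

definition GammaDot :: "nat \<Rightarrow> nat \<Rightarrow> nat \<Rightarrow> real" where
  "GammaDot w i j = real (fact (w div 2 ^ i) ^ (2 ^ i)) /
     (2 ^ ((j - i) * (j + i + 1) div 2) * real (fact (w div 2 ^ j) ^ (2 ^ j))
       * (\<Prod>s = 1..j - i. (2 ^ s - 1)))"

end

theory Submission
  imports Defs "HOL-Library.FuncSet"
begin

text \<open>The dual code of an STS on \<open>n = w - 1\<close> points, i.e. the set of vectors over GF(2) orthogonal to all
  blocks, has dimension \<open>n\<close> minus the 2-rank. A \<open>j\<close>-tuple of dual vectors is the same thing as a colouring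
  of the points by \<open>GF(2)^j\<close> for which the colours of every block sum to zero. With an extra point 0 of
  colour 0 added, every nonzero dual vector is balanced, so by Fourier inversion the tuple is linearly
  independent iff the colouring is equitable, with classes of size \<open>q = w / 2^j\<close>.

  For a fixed equitable colouring, the blocks split according to their set of colours. The colour 0 alone
  carries an STS on \<open>q - 1\<close> points, every set \<open>{0, a}\<close> a one-factorization, i.e. a symmetric latin square of
  order \<open>q - 1\<close>, and every line \<open>{a, b, a + b}\<close> a latin square of order \<open>q\<close>. Counting pairs of an STS and
  an independent tuple in two ways gives linear equations for the numbers of STS of the various ranks,
  which Gaussian binomial inversion solves.\<close>

section \<open>Gaussian binomial inversion\<close>

text \<open>A system has rank w-i-1 iff its dual code has dimension i. A code of dimension m
  contains prod_{s<j} (2^m - 2^s) independent j-tuples, which is 0 for m < j, so the equations are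
  triangular. They are also finite in number: an independent m-tuple already forces 2^m to divide w,
  hence m <= k. The weights \<open>mu2\<close> enter as the values of the Moebius function of the
  lattice of subspaces over GF(2).

  The delicate ingredient is the passage from one-factorizations to symmetric latin squares, which
  needs the diagonal of the square to be a permutation. Odd order guarantees this. If w/2^j - 1 is
  even and positive the passage breaks down, but then no STS on that many points exists and both
  sides of the count are 0. Order 0, reached when w = 2^j, is the empty case, where
  \<open>Psi\<close> and \<open>Pi\<close> are both 1.

  In the product of the two \<open>GammaDot\<close> factors, one 2^j comes from fixing the colour of
  the extra point, and 2^(j choose 2) is the power of 2 in the number of independent
  j-tuples.\<close>

definition qfact :: "nat \<Rightarrow> real" where
  "qfact l = (\<Prod>s = 1..l. 2 ^ s - 1)"

lemma qfact_0 [simp]: "qfact 0 = 1"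
  by (simp add: qfact_def)

lemma qfact_Suc: "qfact (Suc l) = qfact l * (2 ^ Suc l - 1)"
  by (simp add: qfact_def)

lemma qfact_pos: "qfact l > 0"
proof (induction l)
  case (Suc l)
  have "(2::real) ^ Suc l > 1"
    by (rule one_less_power) auto
  with Suc show ?case
    unfolding qfact_Suc by (intro mult_pos_pos) auto
qed simp

lemma qfact_nonzero [simp]: "qfact l \<noteq> 0"
  using qfact_pos[of l] by simp

text \<open>The vanishing of the full alternating sum does not lend itself to induction, but its
  partial sums have a closed form: the analogue for Gaussian binomials at 2 of sum_{l<=t} (-1)^l
  C(r+1,l) = (-1)^t C(r,t).\<close>

lemma alternating_qbinomial_partial_sum:
  "t \<le> r \<Longrightarrow> (\<Sum>l\<le>t. mu2 l * (qfact (Suc r) / (qfact l * qfact (Suc r - l))))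
    = (-1) ^ t * 2 ^ (Suc t choose 2) * (qfact r / (qfact t * qfact (r - t)))"
proof (induction t)
  case 0
  then show ?case
    by (simp add: mu2_def binomial_eq_0)
next
  case (Suc t)
  define d where "d = r - Suc t"
  have r: "r = t + Suc d"
    using Suc.prems by (simp add: d_def)
  have ch: "Suc (Suc t) choose 2 = (Suc t choose 2) + Suc t"
    by (simp add: numeral_2_eq_2)
  have d: "r - t = Suc d" "Suc r - Suc t = Suc d" "r - Suc t = d"
    using r by auto
  have nz: "(2::real) ^ Suc l - 1 \<noteq> 0" for l
    using one_less_power[of "2::real" "Suc l"] by simp
  \<comment> \<open>With r = t + d + 1 all truncated subtractions are gone, and the induction step
    is a rational identity in the two powers \<open>X\<close> and \<open>Y\<close>.\<close>
  define X where "X = (2::real) ^ Suc t"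
  define Y where "Y = (2::real) ^ Suc d"
  have XY: "(2::real) ^ Suc r = X * Y"
    unfolding X_def Y_def r power_add[symmetric] by simp
  have X: "X - 1 \<noteq> 0" and Y: "Y - 1 \<noteq> 0"
    using nz unfolding X_def Y_def by auto
  show ?case
    using Suc.IH Suc.prems X Y
    by (simp only: sum.atMost_Suc mu2_def ch power_add d qfact_Suc XY X_def[symmetric] Y_def[symmetric])
      (simp add: divide_simps, simp add: algebra_simps)
qed

text \<open>The last summand cancels the closed form of the partial sum before it. This is the
  orthogonality relation behind the inversion.\<close>

lemma alternating_qbinomial_sum:
  "(\<Sum>l\<le>r. mu2 l / (qfact l * qfact (r - l))) = (if r = 0 then 1 else 0)"
proof (cases r)
  case 0
  then show ?thesis by (simp add: mu2_def binomial_eq_0)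
next
  case (Suc r')
  have "qfact r * (\<Sum>l\<le>r. mu2 l / (qfact l * qfact (r - l)))
      = (\<Sum>l\<le>Suc r'. mu2 l * (qfact (Suc r') / (qfact l * qfact (Suc r' - l))))"
    unfolding sum_distrib_left Suc by (rule sum.cong) (auto simp: mult.commute)
  also have "\<dots> = 0"
    unfolding sum.atMost_Suc alternating_qbinomial_partial_sum[OF order_refl] by (simp add: mu2_def)
  finally show ?thesis
    using Suc by simp
qed

lemma choose_two_exponent: "2 ^ (Suc l choose 2) = 2 ^ (l choose 2) * (2::'a::semiring_1) ^ l"
proof -
  have "Suc l choose 2 = (l choose 2) + l"
    by (simp add: numeral_2_eq_2)
  then show ?thesis by (simp add: power_add)
qed

text \<open>Counts ordered independent j-tuples in dimension m. Pulling 2^s out of each factor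
  leaves 2^(m-s) - 1, and the extracted powers multiply to 2^(j choose 2).\<close>

lemma prod_pow2_diff:
  assumes "j \<le> m"
  shows "(\<Prod>s<j. (2::real) ^ m - 2 ^ s) = 2 ^ (j choose 2) * qfact m / qfact (m - j)"
  using assms
proof (induction j)
  case (Suc j)
  have m: "m - j = Suc (m - Suc j)" "m = j + Suc (m - Suc j)"
    using Suc.prems by auto
  have p: "(2::real) ^ m = 2 ^ j * 2 ^ Suc (m - Suc j)"
    by (subst m(2)) (simp only: power_add)
  have "(2::real) ^ Suc (m - Suc j) - 1 \<noteq> 0"
    using one_less_power[of "2::real" "Suc (m - Suc j)"] by simp
  then show ?case
    using Suc by (simp only: prod.lessThan_Suc choose_two_exponent m(1) qfact_Suc p)
      (simp add: divide_simps algebra_simps)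
qed (simp add: binomial_eq_0)

lemma prod_pow2_diff_eq_0:
  assumes "m < j"
  shows "(\<Prod>s<j. (2::real) ^ m - 2 ^ s) = 0"
  using assms by (auto intro!: prod_zero)

text \<open>After inserting \<open>F\<close> and exchanging the sums, the coefficient of
  \<open>a m\<close> is an alternating sum over j. Only i <= j <= m contributes, and with l = j - i
  it becomes the orthogonality relation of length m - i, so only m = i survives.\<close>

lemma gauss_inversion:
  fixes a F :: "nat \<Rightarrow> real"
  assumes F: "\<And>j. j \<le> k \<Longrightarrow> F j = (\<Sum>m\<le>k. a m * (\<Prod>s<j. 2 ^ m - 2 ^ s))"
    and "i \<le> k"
  shows "a i = (\<Sum>j = i..k. mu2 (j - i) * F j / (2 ^ (j choose 2) * qfact i * qfact (j - i)))"
proof -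
  have inner: "(\<Sum>j = i..k. mu2 (j - i) * (\<Prod>s<j. 2 ^ m - 2 ^ s) / (2 ^ (j choose 2) * qfact i * qfact (j - i)))
      = (if m = i then 1 else 0)" (is "sum ?f _ = _") if m: "m \<le> k" for m
  proof (cases "i \<le> m")
    case False
    then show ?thesis
      by (auto intro!: sum.neutral simp: prod_pow2_diff_eq_0)
  next
    case True
    have "sum ?f {i..k} = sum ?f {i..m}"
      using m by (intro sum.mono_neutral_right) (auto simp: prod_pow2_diff_eq_0)
    also have "\<dots> = (\<Sum>l\<le>m - i. ?f (l + i))"
      by (rule sum.reindex_bij_witness[of _ "\<lambda>l. l + i" "\<lambda>j. j - i"]) (use True in auto)
    also have "\<dots> = (\<Sum>l\<le>m - i. qfact m / qfact i * (mu2 l / (qfact l * qfact (m - i - l))))"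
      by (rule sum.cong) (use True in \<open>auto simp: prod_pow2_diff ac_simps\<close>)
    also have "\<dots> = (if m = i then 1 else 0)"
      unfolding sum_distrib_left[symmetric] alternating_qbinomial_sum using True by auto
    finally show ?thesis .
  qed
  have "(\<Sum>j = i..k. mu2 (j - i) * F j / (2 ^ (j choose 2) * qfact i * qfact (j - i)))
      = (\<Sum>j = i..k. \<Sum>m\<le>k. a m * (mu2 (j - i) * (\<Prod>s<j. 2 ^ m - 2 ^ s) / (2 ^ (j choose 2) * qfact i * qfact (j - i))))"
    by (rule sum.cong) (simp_all add: F sum_distrib_left sum_divide_distrib mult_ac)
  also have "\<dots> = (\<Sum>m\<le>k. a m * (if m = i then 1 else 0))"
    by (subst sum.swap, unfold sum_distrib_left[symmetric]) (intro sum.cong refl, simp add: inner)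
  also have "\<dots> = a i"
    using \<open>i \<le> k\<close> by (simp add: if_distrib cong: if_cong)
  finally show ?thesis by simp
qed

text \<open>The factorials of w/2^i cancel, and i(i+1)/2 + (j-i)(j+i+1)/2 = j(j+1)/2 = (j choose 2)
  + j.\<close>

lemma GammaDot_mult:
  assumes "i \<le> j"
  shows "GammaDot w 0 i * GammaDot w i j
    = fact w / (2 ^ (j choose 2) * 2 ^ j * fact (w div 2 ^ j) ^ 2 ^ j * qfact i * qfact (j - i))"
proof -
  \<comment> \<open>The exponents are integer divisions, which may be added only because i(i+1) is
    even.\<close>
  have even: "even (l * (l + 1))" for l :: nat by simp
  obtain d where j: "j = i + d"
    using assms le_Suc_ex by blast
  have "i * (i + 1) + d * (j + i + 1) = j * (j + 1)"
    unfolding j by (simp add: algebra_simps)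
  then have "i * (i + 1) div 2 + d * (j + i + 1) div 2 = j * (j + 1) div 2"
    using even[of i] by (metis div_plus_div_distrib_dvd_left)
  moreover have "j * (j + 1) div 2 = (j choose 2) + j"
    by (cases j) (auto simp: choose_two)
  ultimately have "i * (i + 1) div 2 + (j - i) * (j + i + 1) div 2 = (j choose 2) + j"
    using j by simp
  then have e: "(2::real) ^ (i * (i + 1) div 2) * 2 ^ ((j - i) * (j + i + 1) div 2) = 2 ^ (j choose 2) * 2 ^ j"
    by (simp only: power_add[symmetric])
  show ?thesis
    unfolding GammaDot_def e[symmetric]
    by (simp add: qfact_def)
qed

section \<open>Duality over GF(2)\<close>

text \<open>Addition and multiplication of bits must remain ring operations, so that distributivity
  and the sum lemmas apply to them.\<close>

declare add_bit_eq_xor [simp del] mult_bit_eq_and [simp del]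

interpretation gf2: vector_space gf2_scale
  by unfold_locales (auto simp: gf2_scale_def fun_eq_iff algebra_simps)

lemma gf2_vec_add_self [simp]: "v + v = (0 :: 'a \<Rightarrow> bit)"
  by (auto simp: fun_eq_iff)

lemma gf2_vec_add_eq_0_iff: "u + v = 0 \<longleftrightarrow> u = (v :: 'a \<Rightarrow> bit)"
  by (metis add_right_cancel gf2_vec_add_self)

lemma gf2_bit_add_eq_0_iff: "a + b = 0 \<longleftrightarrow> a = (b :: bit)"
  by (cases a; cases b) auto

lemma sum_fun_apply: "sum f A x = (\<Sum>a\<in>A. f a x)"
  for f :: "'a \<Rightarrow> 'b \<Rightarrow> 'c::comm_monoid_add"
  by (induction A rule: infinite_finite_induct) auto

definition sgn2 :: "bit \<Rightarrow> real" where
  "sgn2 b = (if b = 0 then 1 else -1)"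

lemma sgn2_0 [simp]: "sgn2 0 = 1"
  and sgn2_1 [simp]: "sgn2 1 = -1"
  by (auto simp: sgn2_def)

lemma sgn2_add: "sgn2 (a + b) = sgn2 a * sgn2 b"
  by (cases a; cases b) auto

text \<open>Translation by \<open>u\<close> is an involution of \<open>G\<close> that reverses every
  sign. Both vanishing character sums below come from here.\<close>

lemma sum_sgn2_eq_0:
  fixes G :: "('a::ab_group_add) set"
  assumes "\<And>x. x \<in> G \<Longrightarrow> x + u \<in> G" "\<And>x. x + u + u = x"
    and "\<And>x. x \<in> G \<Longrightarrow> f (x + u) = f x + 1"
  shows "(\<Sum>x\<in>G. sgn2 (f x)) = 0"
proof -
  have "(\<Sum>x\<in>G. sgn2 (f x)) = (\<Sum>x\<in>G. sgn2 (f (x + u)))"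
    by (rule sum.reindex_bij_witness[of _ "\<lambda>x. x + u" "\<lambda>x. x + u"]) (use assms in auto)
  also have "\<dots> = - (\<Sum>x\<in>G. sgn2 (f x))"
    by (simp only: assms(3) sgn2_add sgn2_1 sum_negf mult_minus1_right cong: sum.cong)
  finally show ?thesis by simp
qed

definition vecs :: "'a set \<Rightarrow> ('a \<Rightarrow> bit) set" where
  "vecs X = {v. \<forall>x. x \<notin> X \<longrightarrow> v x = 0}"

lemma vecs_add: "u \<in> vecs X \<Longrightarrow> v \<in> vecs X \<Longrightarrow> u + v \<in> vecs X"
  and vecs_0: "0 \<in> vecs X"
  by (auto simp: vecs_def)

lemma vecs_eq_image: "vecs X = (\<lambda>A x. of_bool (x \<in> A)) ` Pow X"
proof -
  have "v \<in> (\<lambda>A x. of_bool (x \<in> A)) ` Pow X" if "v \<in> vecs X" for v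
  proof
    show "v = (\<lambda>x. of_bool (x \<in> {x. v x = 1}))"
      by (rule ext, rename_tac x, case_tac "v x") auto
    show "{x. v x = 1} \<in> Pow X"
      using that by (auto simp: vecs_def)
  qed
  then show ?thesis
    by (auto simp: vecs_def)
qed

lemma card_vecs: "card (vecs X) = 2 ^ card X" if "finite X"
proof -
  have "inj_on (\<lambda>A x. of_bool (x \<in> A) :: bit) (Pow X)"
    by (intro inj_onI) (simp add: fun_eq_iff set_eq_iff of_bool_eq_iff)
  then show ?thesis
    by (simp add: vecs_eq_image card_image card_Pow that)
qed

lemma finite_vecs: "finite X \<Longrightarrow> finite (vecs X)"
  by (simp add: vecs_eq_image)

lemma sum_sgn2_vecs:
  assumes X: "finite X" and u: "u \<in> vecs X"
  shows "(\<Sum>v\<in>vecs X. sgn2 (\<Sum>x\<in>X. u x * v x)) = (if u = 0 then 2 ^ card X else 0)"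
proof (cases "u = 0")
  case True
  then show ?thesis by (simp add: card_vecs X)
next
  case False
  then obtain y where y: "u y \<noteq> 0"
    by (auto simp: fun_eq_iff)
  with u have "y \<in> X" unfolding vecs_def by blast
  \<comment> \<open>The unit vector at a coordinate where \<open>u\<close> is nonzero pairs with
    \<open>u\<close> to 1, so translation by it flips the sign.\<close>
  define e :: "'a \<Rightarrow> bit" where "e = (\<lambda>x. if x = y then 1 else 0)"
  have "e \<in> vecs X" using \<open>y \<in> X\<close> by (auto simp: e_def vecs_def)
  moreover have "(\<Sum>x\<in>X. u x * e x) = 1"
    using \<open>y \<in> X\<close> X y by (simp add: e_def if_distrib cong: if_cong)
  moreover have "(\<Sum>x\<in>X. u x * (v + e) x) = (\<Sum>x\<in>X. u x * v x) + (\<Sum>x\<in>X. u x * e x)" for v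
    by (simp add: distrib_left sum.distrib)
  moreover have "v + e + e = v" for v
    by (simp only: add.assoc gf2_vec_add_self add_0_right)
  ultimately show ?thesis
    using False by (simp del: plus_fun_apply add: sum_sgn2_eq_0[where u = e] vecs_add)
qed

definition ann :: "'a set \<Rightarrow> ('a \<Rightarrow> bit) set \<Rightarrow> ('a \<Rightarrow> bit) set" where
  "ann X W = {v \<in> vecs X. \<forall>u\<in>W. (\<Sum>x\<in>X. u x * v x) = 0}"

text \<open>The double character sum over \<open>W\<close> and all vectors is evaluated in both
  orders. Summing over \<open>W\<close> first gives |W| on the annihilator and 0 elsewhere; summing
  over all vectors first leaves only u = 0. This takes the place of a dimension argument.\<close>

lemma card_ann:
  assumes X: "finite X" and W: "W \<subseteq> vecs X" "0 \<in> W" "\<And>u v. u \<in> W \<Longrightarrow> v \<in> W \<Longrightarrow> u + v \<in> W"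
  shows "card W * card (ann X W) = 2 ^ card X"
proof -
  let ?ip = "\<lambda>u v. \<Sum>x\<in>X. u x * v x :: bit"
  have fin: "finite W" "finite (vecs X)"
    using finite_vecs[OF X] finite_subset[OF W(1)] by auto
  have add: "?ip (u + u') v = ?ip u v + ?ip u' v" "?ip v (u + u') = ?ip v u + ?ip v u'" for u u' v
    by (auto simp: algebra_simps sum.distrib)
  have self: "x + u + u = x" for x u :: "'a \<Rightarrow> bit"
    by (simp add: add.assoc)
  have 1: "(\<Sum>u\<in>W. sgn2 (?ip u v)) = (if v \<in> ann X W then real (card W) else 0)" if v: "v \<in> vecs X" for v
  proof (cases "v \<in> ann X W")
    case True
    then show ?thesis by (simp add: ann_def)
  next
    case False
    then obtain u where "u \<in> W" "?ip u v = 1"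
      using v by (auto simp: ann_def)
    then show ?thesis
      using False W by (simp del: plus_fun_apply add: sum_sgn2_eq_0[where u = u] self add)
  qed
  have 2: "(\<Sum>v\<in>vecs X. sgn2 (?ip u v)) = (if u = 0 then 2 ^ card X else 0)" if "u \<in> W" for u
    using that W sum_sgn2_vecs[OF X] by blast
  have "(\<Sum>v\<in>vecs X. \<Sum>u\<in>W. sgn2 (?ip u v)) = real (card W) * card (ann X W)"
    using fin by (simp add: 1 flip: sum.inter_filter) (auto simp: ann_def intro!: arg_cong[of _ _ card])
  moreover have "(\<Sum>u\<in>W. \<Sum>v\<in>vecs X. sgn2 (?ip u v)) = 2 ^ card X"
    using fin W by (simp add: 2)
  ultimately have "real (card W * card (ann X W)) = real (2 ^ card X)"
    by (simp add: sum.swap[of _ W])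
  then show ?thesis by linarith
qed

lemma (in vector_space) dim_span_witness:
  assumes "finite (span V)"
  obtains B where "B \<subseteq> V" "independent B" "finite B" "span B = span V" "card B = dim V"
proof -
  obtain B where B: "B \<subseteq> V" "independent B" "V \<subseteq> span B" "card B = dim V"
    using basis_exists .
  moreover have "finite B"
    by (rule finite_subset[OF _ assms]) (use B(1) span_superset in auto)
  moreover have "span B = span V"
    using B(1,3) by (intro subset_antisym span_mono span_minimal subspace_span)
  ultimately show thesis using that by simp
qed

text \<open>Coefficient vectors on a basis parametrise the span. Since subtraction is addition over
  GF(2), injectivity follows by applying independence to the sum of two coefficient vectors.\<close>

lemma card_gf2_span:
  assumes "finite (gf2.span V)"
  shows "card (gf2.span V) = 2 ^ gf2.dim V"
proof -
  obtain B where "B \<subseteq> V" and B: "gf2.independent B" "finite B" "gf2.span B = gf2.span V" "card B = gf2.dim V"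
    by (rule gf2.dim_span_witness[OF assms])
  define f where "f c = (\<Sum>v\<in>B. gf2_scale (c v) v)" for c
  have "f c \<in> f ` vecs B" for c
  proof
    show "f c = f (\<lambda>v. if v \<in> B then c v else 0)"
      unfolding f_def by (rule sum.cong) auto
    show "(\<lambda>v. if v \<in> B then c v else 0) \<in> vecs B"
      by (auto simp: vecs_def)
  qed
  then have "range f = f ` vecs B"
    by (intro subset_antisym subsetI) auto
  then have "gf2.span B = f ` vecs B"
    unfolding gf2.span_finite[OF B(2)] f_def[abs_def] .
  moreover have "inj_on f (vecs B)"
  proof (rule inj_onI)
    fix c d assume cd: "c \<in> vecs B" "d \<in> vecs B" "f c = f d"
    have "(\<Sum>v\<in>B. gf2_scale (c v + d v) v) = f c + f d"
      unfolding gf2.scale_left_distrib sum.distrib f_def ..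
    then have "(\<Sum>v\<in>B. gf2_scale (c v + d v) v) = 0"
      by (simp only: cd(3) gf2_vec_add_self)
    then have "c v + d v = 0" if "v \<in> B" for v
      using gf2.independentD[OF B(1,2) subset_refl, of "\<lambda>v. c v + d v" v] that by blast
    then have "\<forall>v\<in>B. c v = d v"
      using gf2_bit_add_eq_0_iff by blast
    then show "c = d"
      using cd by (auto simp: vecs_def fun_eq_iff)
  qed
  ultimately show ?thesis
    unfolding B(3,4)[symmetric] using B(2) by (simp add: card_image card_vecs)
qed

section \<open>Exactly covering block systems\<close>

text \<open>A common frame for triple systems, one-factorizations and latin squares: admissible
  blocks and pairs to be covered are separate parameters, because a colour type restricts
  both.\<close>

definition exact_systems :: "'a set set \<Rightarrow> 'a set set \<Rightarrow> 'a set set set" where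
  "exact_systems BB P = {S. S \<subseteq> BB \<and> (\<forall>p\<in>P. \<exists>!b. b \<in> S \<and> p \<subseteq> b)}"

text \<open>A block covers only pairs of its own type, so the parts of a system belonging to
  different types are chosen independently.\<close>

lemma card_exact_systems_prod:
  assumes "finite T" and tT: "\<And>b. b \<in> BB \<Longrightarrow> t b \<in> T" and uT: "\<And>p. p \<in> P \<Longrightarrow> u p \<in> T"
    and ut: "\<And>p b. p \<in> P \<Longrightarrow> b \<in> BB \<Longrightarrow> p \<subseteq> b \<Longrightarrow> u p = t b"
  shows "card (exact_systems BB P)
    = (\<Prod>\<tau>\<in>T. card (exact_systems {b \<in> BB. t b = \<tau>} {p \<in> P. u p = \<tau>}))"
proof -
  let ?E = "\<lambda>\<tau>. exact_systems {b \<in> BB. t b = \<tau>} {p \<in> P. u p = \<tau>}"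
  have "bij_betw (\<lambda>S. \<lambda>\<tau>\<in>T. {b \<in> S. t b = \<tau>}) (exact_systems BB P) (PiE T ?E)"
  proof (rule bij_betw_byWitness[where f' = "\<lambda>g. \<Union>\<tau>\<in>T. g \<tau>"])
    show "\<forall>S\<in>exact_systems BB P. (\<Union>\<tau>\<in>T. (\<lambda>\<tau>\<in>T. {b \<in> S. t b = \<tau>}) \<tau>) = S"
      using tT by (auto simp: exact_systems_def)
    have sub: "{b \<in> \<Union>(g ` T). t b = \<tau>} = g \<tau>" if "g \<in> PiE T ?E" "\<tau> \<in> T" for g \<tau>
      using that by (auto simp: exact_systems_def PiE_iff)
    then show "\<forall>g\<in>PiE T ?E. (\<lambda>\<tau>\<in>T. {b \<in> \<Union>(g ` T). t b = \<tau>}) = g"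
      by (auto simp: fun_eq_iff PiE_iff extensional_def)
    show "(\<lambda>S. \<lambda>\<tau>\<in>T. {b \<in> S. t b = \<tau>}) ` exact_systems BB P \<subseteq> PiE T ?E"
    proof (intro image_subsetI restrict_PiE_iff[THEN iffD2] ballI)
      fix S \<tau> assume "S \<in> exact_systems BB P"
      then have S: "S \<subseteq> BB" "\<And>p. p \<in> P \<Longrightarrow> \<exists>!b. b \<in> S \<and> p \<subseteq> b"
        by (auto simp: exact_systems_def)
      have "\<exists>!b. b \<in> {b \<in> S. t b = \<tau>} \<and> p \<subseteq> b" if p: "p \<in> P" "u p = \<tau>" for p
      proof -
        have "b \<in> {b \<in> S. t b = \<tau>} \<and> p \<subseteq> b \<longleftrightarrow> b \<in> S \<and> p \<subseteq> b" for b
          using ut[OF p(1)] S(1) p(2) by auto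
        then show ?thesis
          using S(2)[OF p(1)] by simp
      qed
      then show "{b \<in> S. t b = \<tau>} \<in> ?E \<tau>"
        using S(1) by (auto simp: exact_systems_def)
    qed
    show "(\<lambda>g. \<Union>(g ` T)) ` PiE T ?E \<subseteq> exact_systems BB P"
    proof
      fix S assume "S \<in> (\<lambda>g. \<Union>(g ` T)) ` PiE T ?E"
      then obtain g where g: "g \<in> PiE T ?E" and S: "S = \<Union>(g ` T)" by blast
      have SB: "S \<subseteq> BB"
        using g unfolding S by (auto simp: exact_systems_def PiE_iff)
      have "\<exists>!b. b \<in> S \<and> p \<subseteq> b" if p: "p \<in> P" for p
      proof -
        have "b \<in> g (u p) \<longleftrightarrow> b \<in> S \<and> t b = u p" for b
          unfolding sub[OF g uT[OF p], symmetric] S by simp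
        then have "b \<in> g (u p) \<and> p \<subseteq> b \<longleftrightarrow> b \<in> S \<and> p \<subseteq> b" for b
          using ut[OF p] SB by auto
        moreover have "\<exists>!b. b \<in> g (u p) \<and> p \<subseteq> b"
          using PiE_mem[OF g uT[OF p]] p by (auto simp: exact_systems_def)
        ultimately show ?thesis by simp
      qed
      then show "S \<in> exact_systems BB P"
        using SB by (simp add: exact_systems_def)
    qed
  qed
  from bij_betw_same_card[OF this] show ?thesis
    by (simp add: card_PiE[OF \<open>finite T\<close>])
qed

lemma card_exact_systems_image:
  assumes inj: "inj_on \<phi> X" and BB: "BB \<subseteq> Pow X" and P: "P \<subseteq> Pow X"
  shows "card (exact_systems ((`) \<phi> ` BB) ((`) \<phi> ` P)) = card (exact_systems BB P)"
proof -
  have injP: "inj_on ((`) \<phi>) BB"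
    using inj BB by (meson inj_on_image_Pow inj_on_subset)
  have key: "(\<exists>!c. c \<in> (`) \<phi> ` S \<and> \<phi> ` p \<subseteq> c) \<longleftrightarrow> (\<exists>!b. b \<in> S \<and> p \<subseteq> b)"
    if "S \<subseteq> BB" "p \<in> P" for S p
  proof -
    have sub: "\<phi> ` p \<subseteq> \<phi> ` b \<longleftrightarrow> p \<subseteq> b" if "b \<in> S" for b
    proof -
      have "b \<subseteq> X" "p \<subseteq> X"
        using \<open>S \<subseteq> BB\<close> \<open>b \<in> S\<close> \<open>p \<in> P\<close> BB P by auto
      then show ?thesis
        using inj_on_image_mem_iff[OF inj] by blast
    qed
    have eq: "\<phi> ` b = \<phi> ` b' \<longleftrightarrow> b = b'" if "b \<in> S" "b' \<in> S" for b b'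
      using inj_onD[OF injP, of b b'] that \<open>S \<subseteq> BB\<close> by auto
    show ?thesis
      unfolding Ex1_def bex_simps(8)[symmetric] using sub eq by (smt (verit) imageE imageI)
  qed
  have "bij_betw ((`) ((`) \<phi>)) (exact_systems BB P) (exact_systems ((`) \<phi> ` BB) ((`) \<phi> ` P))"
    unfolding bij_betw_def
  proof
    show "inj_on ((`) ((`) \<phi>)) (exact_systems BB P)"
      by (rule inj_on_subset[OF inj_on_image_Pow[OF injP]]) (auto simp: exact_systems_def)
    show "(`) ((`) \<phi>) ` exact_systems BB P = exact_systems ((`) \<phi> ` BB) ((`) \<phi> ` P)"
    proof (intro subset_antisym subsetI)
      fix S' assume "S' \<in> (`) ((`) \<phi>) ` exact_systems BB P"
      then obtain S where S: "S \<subseteq> BB" "\<And>p. p \<in> P \<Longrightarrow> \<exists>!b. b \<in> S \<and> p \<subseteq> b" "S' = (`) \<phi> ` S"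
        by (auto simp: exact_systems_def)
      have "\<exists>!c. c \<in> S' \<and> \<phi> ` p \<subseteq> c" if "p \<in> P" for p
        unfolding S(3) by (rule key[OF S(1) that, THEN iffD2, OF S(2)[OF that]])
      then show "S' \<in> exact_systems ((`) \<phi> ` BB) ((`) \<phi> ` P)"
        using S by (simp add: exact_systems_def image_mono)
    next
      fix S' assume S': "S' \<in> exact_systems ((`) \<phi> ` BB) ((`) \<phi> ` P)"
      then obtain S where S: "S \<subseteq> BB" "S' = (`) \<phi> ` S"
      proof -
        have "S' \<subseteq> (`) \<phi> ` BB"
          using S' by (simp add: exact_systems_def)
        then show thesis
          using that subset_imageE by metis
      qed
      have "\<exists>!b. b \<in> S \<and> p \<subseteq> b" if "p \<in> P" for p
        by (rule key[OF S(1) that, THEN iffD1]) (use S' that S(2) in \<open>simp add: exact_systems_def\<close>)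
      with S have "S \<in> exact_systems BB P"
        by (simp add: exact_systems_def)
      with S show "S' \<in> (`) ((`) \<phi>) ` exact_systems BB P"
        by blast
    qed
  qed
  from bij_betw_same_card[OF this] show ?thesis by (rule sym)
qed

section \<open>Steiner triple systems as exact systems\<close>

lemma is_STS_iff_exact:
  "is_STS n S \<longleftrightarrow> S \<in> exact_systems {b. b \<subseteq> {1..n} \<and> card b = 3} {p. p \<subseteq> {1..n} \<and> card p = 2}"
  by (auto simp: is_STS_def exact_systems_def)

lemma image_Collect_subsets_card:
  assumes "bij_betw \<phi> X Y"
  shows "(`) \<phi> ` {b. b \<subseteq> X \<and> card b = k} = {b. b \<subseteq> Y \<and> card b = k}"
proof (intro subset_antisym subsetI)
  fix c assume "c \<in> (`) \<phi> ` {b. b \<subseteq> X \<and> card b = k}"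
  then show "c \<in> {b. b \<subseteq> Y \<and> card b = k}"
    using assms by (auto simp: bij_betw_def card_image inj_on_subset)
next
  fix c assume c: "c \<in> {b. b \<subseteq> Y \<and> card b = k}"
  then obtain b where b: "b \<subseteq> X" "c = \<phi> ` b"
    using assms by (auto simp: bij_betw_def subset_image_iff)
  then have "card b = card c"
    using assms by (metis bij_betw_def card_image inj_on_subset)
  with b c show "c \<in> (`) \<phi> ` {b. b \<subseteq> X \<and> card b = k}"
    by auto
qed

lemma card_exact_systems_STS:
  assumes "finite X"
  shows "card (exact_systems {b. b \<subseteq> X \<and> card b = 3} {p. p \<subseteq> X \<and> card p = 2}) = Psi (card X)"
proof -
  obtain \<phi> where \<phi>: "bij_betw \<phi> {1..card X} X"
    using ex_bij_betw_nat_finite_1[OF assms] by blast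
  show ?thesis
    unfolding Psi_def is_STS_iff_exact Collect_mem_eq image_Collect_subsets_card[OF \<phi>, symmetric]
    by (rule card_exact_systems_image) (use \<phi> in \<open>auto simp: bij_betw_def\<close>)
qed

text \<open>The blocks through the point 1, with that point removed, partition the remaining u - 1
  points into pairs. Needed for the colour classes whose size rules out the latin square
  encoding.\<close>

lemma Psi_even_eq_0:
  assumes "even u" "u > 0"
  shows "Psi u = 0"
proof -
  have False if S: "is_STS u S" for S
  proof -
    let ?N = "{1..u} - {1}"
    define D where "D = (\<lambda>b. b - {1}) ` {b \<in> S. 1 \<in> b}"
    have b: "b \<subseteq> {1..u}" "card b = 3" if "b \<in> S" for b
      using S that by (auto simp: is_STS_def)
    have uniq: "\<exists>!b. b \<in> S \<and> {1, y} \<subseteq> b" if "y \<in> ?N" for y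
    proof -
      have "{1, y} \<subseteq> {1..u} \<and> card {1, y} = 2"
        using that \<open>u > 0\<close> by auto
      moreover have "\<forall>p. p \<subseteq> {1..u} \<and> card p = 2 \<longrightarrow> (\<exists>!b. b \<in> S \<and> p \<subseteq> b)"
        using S by (simp add: is_STS_def)
      ultimately show ?thesis by (elim allE[of _ "{1, y}"] mp)
    qed
    have "\<Union>D = ?N"
    proof
      show "\<Union>D \<subseteq> ?N"
        using b by (fastforce simp: D_def)
      show "?N \<subseteq> \<Union>D"
      proof
        fix y assume y: "y \<in> ?N"
        then obtain b where "b \<in> S" "{1, y} \<subseteq> b" using uniq by blast
        then show "y \<in> \<Union>D" using y by (auto simp: D_def)
      qed
    qed
    moreover have "card (\<Union>D) = sum card D"
    proof (rule card_Union_disjoint)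
      show "pairwise disjnt D"
      proof (rule pairwiseI, rule ccontr)
        fix d e assume de: "d \<in> D" "e \<in> D" "d \<noteq> e" "\<not> disjnt d e"
        then obtain a c y where ac: "a \<in> S" "c \<in> S" "1 \<in> a" "1 \<in> c" "d = a - {1}" "e = c - {1}" "y \<in> d" "y \<in> e"
          by (auto simp: D_def disjnt_def)
        then have "y \<in> ?N" using b by fastforce
        with uniq ac have "a = c" by blast
        with ac de show False by simp
      qed
      show "finite d" if "d \<in> D" for d
        using that b by (auto simp: D_def intro: finite_subset)
    qed
    moreover have "card d = 2" if "d \<in> D" for d
      using that b by (auto simp: D_def card_Diff_singleton)
    ultimately have "card ?N = card D * 2"
      by simp
    then have "u = Suc (card D * 2)"
      using \<open>u > 0\<close> by simp
    then show False using \<open>even u\<close> by simp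
  qed
  then have "{S. is_STS u S} = {}" by blast
  then show ?thesis by (simp add: Psi_def)
qed

section \<open>Latin squares and one-factorizations as exact systems\<close>

lemma bij_betw_endo:
  assumes "finite Q" "f ` Q \<subseteq> Q" "inj_on f Q"
  shows "bij_betw f Q Q"
  using assms by (simp add: bij_betw_def endo_inj_surj)

lemma bij_betw_ex1: "bij_betw f A B \<Longrightarrow> b \<in> B \<Longrightarrow> \<exists>!a. a \<in> A \<and> f a = b"
  by (auto simp: bij_betw_def inj_on_def)

text \<open>Rows, columns and symbols are the points of \<open>A\<close>, \<open>B\<close> and
  \<open>C\<close>, and a block records one cell. Covering the pairs of A x B makes the square a
  function; covering A x C and B x C puts every symbol exactly once into each row and each
  column.\<close>

lemma card_exact_systems_latin:
  assumes fin: "finite A" "finite B" "finite C" and card: "card A = q" "card B = q" "card C = q"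
    and disj: "A \<inter> B = {}" "A \<inter> C = {}" "B \<inter> C = {}"
  assumes BB: "BB = {{x, y, z} |x y z. x \<in> A \<and> y \<in> B \<and> z \<in> C}"
    and P: "P = (\<lambda>(x, y). {x, y}) ` (A \<times> B \<union> A \<times> C \<union> B \<times> C)"
  shows "card (exact_systems BB P) = Lambda q"
proof -
  define Q where "Q = {1..q}"
  obtain \<alpha> where \<alpha>: "bij_betw \<alpha> Q A"
    using ex_bij_betw_nat_finite_1[OF fin(1)] card Q_def by metis
  obtain \<beta> where \<beta>: "bij_betw \<beta> Q B"
    using ex_bij_betw_nat_finite_1[OF fin(2)] card Q_def by metis
  obtain \<gamma> where \<gamma>: "bij_betw \<gamma> Q C"
    using ex_bij_betw_nat_finite_1[OF fin(3)] card Q_def by metis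
  have A: "A = \<alpha> ` Q" and B: "B = \<beta> ` Q" and C: "C = \<gamma> ` Q"
    using \<alpha> \<beta> \<gamma> by (auto simp: bij_betw_def)
  have inj: "inj_on \<alpha> Q" "inj_on \<beta> Q" "inj_on \<gamma> Q"
    using \<alpha> \<beta> \<gamma> by (auto simp: bij_betw_def)
  have ne: "\<alpha> x \<noteq> \<beta> y" "\<alpha> x \<noteq> \<gamma> y" "\<beta> x \<noteq> \<gamma> y" if "x \<in> Q" "y \<in> Q" for x y
    using disj that unfolding A B C by blast+
  note ne' = ne[symmetric]
  define blk where "blk x y z = {\<alpha> x, \<beta> y, \<gamma> z}" for x y z
  have blk_eq: "blk x y z = blk x' y' z' \<longleftrightarrow> x = x' \<and> y = y' \<and> z = z'"
    if "x \<in> Q" "y \<in> Q" "z \<in> Q" "x' \<in> Q" "y' \<in> Q" "z' \<in> Q" for x y z x' y' z'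
    using that ne ne' inj_on_eq_iff[OF inj(1)] inj_on_eq_iff[OF inj(2)] inj_on_eq_iff[OF inj(3)]
    by (auto simp: blk_def insert_eq_iff doubleton_eq_iff)
  note inj_iff = inj_on_eq_iff[OF inj(1)] inj_on_eq_iff[OF inj(2)] inj_on_eq_iff[OF inj(3)]
  have sub: "{\<alpha> x, \<beta> y} \<subseteq> blk x' y' z' \<longleftrightarrow> x = x' \<and> y = y'" if "x \<in> Q" "y \<in> Q" "x' \<in> Q" "y' \<in> Q" "z' \<in> Q"
    for x y x' y' z'
    using that ne ne' inj_iff by (auto simp: blk_def)
  have sub': "{\<alpha> x, \<gamma> z} \<subseteq> blk x' y' z' \<longleftrightarrow> x = x' \<and> z = z'" if "x \<in> Q" "z \<in> Q" "x' \<in> Q" "y' \<in> Q" "z' \<in> Q"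
    for x z x' y' z'
    using that ne ne' inj_iff by (auto simp: blk_def)
  have sub'': "{\<beta> y, \<gamma> z} \<subseteq> blk x' y' z' \<longleftrightarrow> y = y' \<and> z = z'" if "y \<in> Q" "z \<in> Q" "x' \<in> Q" "y' \<in> Q" "z' \<in> Q"
    for y z x' y' z'
    using that ne ne' inj_iff by (auto simp: blk_def)
  have BB: "BB = {blk x y z |x y z. x \<in> Q \<and> y \<in> Q \<and> z \<in> Q}"
    unfolding BB blk_def A B C by blast
  have exact_iff: "S \<in> exact_systems BB P \<longleftrightarrow> S \<subseteq> BB
      \<and> (\<forall>x\<in>Q. \<forall>y\<in>Q. \<exists>!z. z \<in> Q \<and> blk x y z \<in> S)
      \<and> (\<forall>x\<in>Q. \<forall>z\<in>Q. \<exists>!y. y \<in> Q \<and> blk x y z \<in> S)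
      \<and> (\<forall>y\<in>Q. \<forall>z\<in>Q. \<exists>!x. x \<in> Q \<and> blk x y z \<in> S)" for S
  proof (cases "S \<subseteq> BB")
    case True
    \<comment> \<open>The blocks over a fixed pair are parametrised injectively by their remaining
      coordinate, so unique existence moves from blocks to that coordinate.\<close>
    have transfer: "(\<exists>!b. b \<in> S \<and> p \<subseteq> b) \<longleftrightarrow> (\<exists>!t. t \<in> Q \<and> g t \<in> S)"
      if "\<And>b. b \<in> S \<and> p \<subseteq> b \<longleftrightarrow> b \<in> S \<and> b \<in> g ` Q" "inj_on g Q" for p g
      unfolding that(1) using inj_onD[OF that(2)] by (smt (verit) imageE imageI)
    have 1: "(\<exists>!b. b \<in> S \<and> {\<alpha> x, \<beta> y} \<subseteq> b) \<longleftrightarrow> (\<exists>!z. z \<in> Q \<and> blk x y z \<in> S)"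
      if "x \<in> Q" "y \<in> Q" for x y
    proof (rule transfer)
      show "inj_on (blk x y) Q" using blk_eq that by (auto intro!: inj_onI)
      show "b \<in> S \<and> {\<alpha> x, \<beta> y} \<subseteq> b \<longleftrightarrow> b \<in> S \<and> b \<in> blk x y ` Q" for b
      proof (cases "b \<in> S")
        case True
        with \<open>S \<subseteq> BB\<close> obtain x' y' z' where "b = blk x' y' z'" "x' \<in> Q" "y' \<in> Q" "z' \<in> Q"
          unfolding BB by blast
        with that True show ?thesis
          by (auto simp: sub blk_eq image_iff simp del: insert_subset)
      qed simp
    qed
    have 2: "(\<exists>!b. b \<in> S \<and> {\<alpha> x, \<gamma> z} \<subseteq> b) \<longleftrightarrow> (\<exists>!y. y \<in> Q \<and> blk x y z \<in> S)"
      if "x \<in> Q" "z \<in> Q" for x z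
    proof (rule transfer)
      show "inj_on (\<lambda>y. blk x y z) Q" using blk_eq that by (auto intro!: inj_onI)
      show "b \<in> S \<and> {\<alpha> x, \<gamma> z} \<subseteq> b \<longleftrightarrow> b \<in> S \<and> b \<in> (\<lambda>y. blk x y z) ` Q" for b
      proof (cases "b \<in> S")
        case True
        with \<open>S \<subseteq> BB\<close> obtain x' y' z' where "b = blk x' y' z'" "x' \<in> Q" "y' \<in> Q" "z' \<in> Q"
          unfolding BB by blast
        with that True show ?thesis
          by (auto simp: sub' blk_eq image_iff simp del: insert_subset)
      qed simp
    qed
    have 3: "(\<exists>!b. b \<in> S \<and> {\<beta> y, \<gamma> z} \<subseteq> b) \<longleftrightarrow> (\<exists>!x. x \<in> Q \<and> blk x y z \<in> S)"
      if "y \<in> Q" "z \<in> Q" for y z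
    proof (rule transfer)
      show "inj_on (\<lambda>x. blk x y z) Q" using blk_eq that by (auto intro!: inj_onI)
      show "b \<in> S \<and> {\<beta> y, \<gamma> z} \<subseteq> b \<longleftrightarrow> b \<in> S \<and> b \<in> (\<lambda>x. blk x y z) ` Q" for b
      proof (cases "b \<in> S")
        case True
        with \<open>S \<subseteq> BB\<close> obtain x' y' z' where "b = blk x' y' z'" "x' \<in> Q" "y' \<in> Q" "z' \<in> Q"
          unfolding BB by blast
        with that True show ?thesis
          by (auto simp: sub'' blk_eq image_iff simp del: insert_subset)
      qed simp
    qed
    have "(\<forall>p\<in>P. \<Phi> p) \<longleftrightarrow> (\<forall>x\<in>Q. \<forall>y\<in>Q. \<Phi> {\<alpha> x, \<beta> y}) \<and>
        (\<forall>x\<in>Q. \<forall>z\<in>Q. \<Phi> {\<alpha> x, \<gamma> z}) \<and> (\<forall>y\<in>Q. \<forall>z\<in>Q. \<Phi> {\<beta> y, \<gamma> z})" for \<Phi>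
      unfolding P A B C by (simp add: ball_Un)
    with True show ?thesis
      by (simp add: exact_systems_def 1 2 3 del: insert_subset)
  next
    case False
    then show ?thesis by (simp add: exact_systems_def)
  qed
  define F where "F f = {blk x y (f x y) |x y. x \<in> Q \<and> y \<in> Q}" for f
  have latin: "f x y \<in> Q" if "f \<in> latin_squares q" "x \<in> Q" "y \<in> Q" for f x y
  proof -
    have "bij_betw (f x) Q Q"
      using that unfolding latin_squares_def Q_def by simp
    with that show ?thesis by (auto dest: bij_betwE)
  qed
  have F_iff: "blk x y z \<in> F f \<longleftrightarrow> f x y = z" if "f \<in> latin_squares q" "x \<in> Q" "y \<in> Q" "z \<in> Q" for f x y z
    using that latin[OF that(1)] blk_eq unfolding F_def by (auto 4 4)
  have "bij_betw F (latin_squares q) (exact_systems BB P)"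
    unfolding bij_betw_def
  proof
    show "inj_on F (latin_squares q)"
    proof (rule inj_onI)
      fix f g assume fg: "f \<in> latin_squares q" "g \<in> latin_squares q" "F f = F g"
      have "f x y = g x y" if "x \<in> Q" "y \<in> Q" for x y
        using F_iff[OF fg(1) that latin[OF fg(1) that]] F_iff[OF fg(2) that latin[OF fg(1) that]] fg(3) by simp
      moreover have "f x y = g x y" if "x \<notin> Q \<or> y \<notin> Q" for x y
        using that fg(1,2) by (auto simp: latin_squares_def Q_def)
      ultimately show "f = g" by blast
    qed
    show "F ` latin_squares q = exact_systems BB P"
    proof (intro subset_antisym subsetI)
      fix S assume "S \<in> F ` latin_squares q"
      then obtain f where f: "f \<in> latin_squares q" "S = F f" by blast
      have row: "bij_betw (f x) Q Q" and col: "bij_betw (\<lambda>y. f y x) Q Q" if "x \<in> Q" for x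
        using f(1) that by (auto simp: latin_squares_def Q_def)
      show "S \<in> exact_systems BB P"
        unfolding exact_iff f(2)
      proof (intro conjI ballI)
        show "F f \<subseteq> BB"
          using latin[OF f(1)] unfolding F_def BB by blast
        fix s t assume st: "s \<in> Q" "t \<in> Q"
        have "z \<in> Q \<and> blk s t z \<in> F f \<longleftrightarrow> z = f s t" for z
          using F_iff[OF f(1) st, of z] latin[OF f(1) st] by auto
        then show "\<exists>!z. z \<in> Q \<and> blk s t z \<in> F f" by simp
        have "y \<in> Q \<and> blk s y t \<in> F f \<longleftrightarrow> y \<in> Q \<and> f s y = t" for y
          using F_iff[OF f(1) st(1) _ st(2), of y] by auto
        then show "\<exists>!y. y \<in> Q \<and> blk s y t \<in> F f"
          using bij_betw_ex1[OF row[OF st(1)] st(2)] by simp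
        have "x \<in> Q \<and> blk x s t \<in> F f \<longleftrightarrow> x \<in> Q \<and> f x s = t" for x
          using F_iff[OF f(1) _ st, of x] by auto
        then show "\<exists>!x. x \<in> Q \<and> blk x s t \<in> F f"
          using bij_betw_ex1[OF col[OF st(1)] st(2)] by simp
      qed
    next
      fix S assume "S \<in> exact_systems BB P"
      then have S: "S \<subseteq> BB"
        and z: "\<And>x y. x \<in> Q \<Longrightarrow> y \<in> Q \<Longrightarrow> \<exists>!z. z \<in> Q \<and> blk x y z \<in> S"
        and y: "\<And>x z. x \<in> Q \<Longrightarrow> z \<in> Q \<Longrightarrow> \<exists>!y. y \<in> Q \<and> blk x y z \<in> S"
        and x: "\<And>y z. y \<in> Q \<Longrightarrow> z \<in> Q \<Longrightarrow> \<exists>!x. x \<in> Q \<and> blk x y z \<in> S"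
        unfolding exact_iff by auto
      \<comment> \<open>The value 0 outside the index range is the one that
        \<open>latin_squares\<close> prescribes.\<close>
      define f where "f x y = (if x \<in> Q \<and> y \<in> Q then THE z. z \<in> Q \<and> blk x y z \<in> S else 0)" for x y
      have f: "f x y \<in> Q" "blk x y (f x y) \<in> S" if "x \<in> Q" "y \<in> Q" for x y
        using theI'[OF z[OF that]] that by (auto simp: f_def)
      have f_eq: "f x y = z" if "x \<in> Q" "y \<in> Q" "z \<in> Q" "blk x y z \<in> S" for x y z
        using the1_equality[OF z[OF that(1,2)]] that by (auto simp: f_def)
      have "bij_betw (f x) Q Q" if "x \<in> Q" for x
      proof (rule bij_betw_endo)
        show "inj_on (f x) Q"
        proof (rule inj_onI)
          fix s t assume st: "s \<in> Q" "t \<in> Q" "f x s = f x t"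
          have "blk x s (f x t) \<in> S" using f(2)[OF that st(1)] st(3) by simp
          with y[OF that f(1)[OF that st(2)]] f(2)[OF that st(2)] st show "s = t" by blast
        qed
      qed (use f that in \<open>auto simp: Q_def\<close>)
      moreover have "bij_betw (\<lambda>x. f x y) Q Q" if "y \<in> Q" for y
      proof (rule bij_betw_endo)
        show "inj_on (\<lambda>x. f x y) Q"
        proof (rule inj_onI)
          fix s t assume st: "s \<in> Q" "t \<in> Q" "f s y = f t y"
          have "blk s y (f t y) \<in> S" using f(2)[OF st(1) that] st(3) by simp
          with x[OF that f(1)[OF st(2) that]] f(2)[OF st(2) that] st show "s = t" by blast
        qed
      qed (use f that in \<open>auto simp: Q_def\<close>)
      ultimately have fl: "f \<in> latin_squares q"
        unfolding latin_squares_def Q_def[symmetric] by (auto simp: f_def)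
      have "F f = S"
      proof
        show "F f \<subseteq> S" using f by (auto simp: F_def)
        show "S \<subseteq> F f"
        proof
          fix b assume "b \<in> S"
          then obtain x y z where "b = blk x y z" "x \<in> Q" "y \<in> Q" "z \<in> Q"
            using S unfolding BB by blast
          with \<open>b \<in> S\<close> show "b \<in> F f"
            using F_iff[OF fl] f_eq by blast
        qed
      qed
      with fl show "S \<in> F ` latin_squares q" by blast
    qed
  qed
  from bij_betw_same_card[OF this] show ?thesis
    by (simp add: Lambda_def)
qed

text \<open>Each symbol occupies u cells, and its off-diagonal cells come in mirror pairs. As u is
  odd, every symbol reaches the diagonal, and by finiteness the diagonal is a permutation.\<close>

lemma symmetric_latin_diagonal:
  assumes f: "f \<in> latin_squares u" and sym: "\<And>x y. f x y = f y x" and "odd u"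
  shows "bij_betw (\<lambda>x. f x x) {1..u} {1..u}"
proof -
  define Q where "Q = {1..u}"
  have fin: "finite Q" by (simp add: Q_def)
  have row: "bij_betw (f x) Q Q" if "x \<in> Q" for x
    using f that unfolding latin_squares_def Q_def by simp
  have "\<exists>x\<in>Q. f x x = z" if z: "z \<in> Q" for z
  proof (rule ccontr)
    assume nd: "\<not> (\<exists>x\<in>Q. f x x = z)"
    define M where "M = (SIGMA x:Q. {y \<in> Q. f x y = z})"
    let ?L = "{(x, y) \<in> M. x < y}" and ?U = "{(x, y) \<in> M. y < x}"
    have "card {y \<in> Q. f x y = z} = 1" if x: "x \<in> Q" for x
    proof -
      obtain y where "{y \<in> Q. f x y = z} = {y}"
        using bij_betw_ex1[OF row[OF x] z] by blast
      then show ?thesis by simp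
    qed
    then have "card M = u"
      using fin by (simp add: M_def Q_def)
    moreover have "M = ?L \<union> ?U"
      using nd by (force simp: M_def not_less_iff_gr_or_eq)
    moreover have "card (?L \<union> ?U) = card ?L + card ?U"
    proof (rule card_Un_disjoint)
      have "finite M" using fin by (simp add: M_def)
      then show "finite ?L" "finite ?U" by (auto intro: finite_subset[of _ M])
    qed auto
    moreover have "bij_betw prod.swap ?L ?U"
      by (rule bij_betwI[where g = prod.swap]) (auto simp: M_def sym)
    then have "card ?L = card ?U"
      by (rule bij_betw_same_card)
    ultimately have "u = 2 * card ?L" by simp
    then show False using \<open>odd u\<close> by simp
  qed
  then have "Q \<subseteq> (\<lambda>x. f x x) ` Q" by blast
  moreover have "(\<lambda>x. f x x) ` Q \<subseteq> Q"
    using row by (auto dest: bij_betwE)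
  ultimately have "(\<lambda>x. f x x) ` Q = Q" by blast
  then have "bij_betw (\<lambda>x. f x x) Q Q"
    using fin by (simp add: bij_betw_def eq_card_imp_inj_on)
  then show ?thesis by (simp add: Q_def)
qed

text \<open>A one-factorization of the complete graph on \<open>Y\<close> with factors labelled by \<open>Z\<close>: one point of \<open>Y\<close>
  plays the role of infinity, and its edge to \<open>x\<close> is stored in the diagonal entry at \<open>x\<close>.\<close>
lemma card_exact_systems_one_factor:
  assumes fin: "finite Z" "finite Y" and card: "card Z = u" "card Y = Suc u"
    and disj: "Z \<inter> Y = {}" and u: "odd u \<or> u = 0"
  assumes BB: "BB = {{z, x, y} |z x y. z \<in> Z \<and> x \<in> Y \<and> y \<in> Y \<and> x \<noteq> y}"
    and P: "P = (\<lambda>(x, y). {x, y}) ` ({(x, y) \<in> Y \<times> Y. x \<noteq> y} \<union> Z \<times> Y)"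
  shows "card (exact_systems BB P) = Defs.Pi u"
proof -
  define Q where "Q = {1..u}"
  define Q0 where "Q0 = {0..u}"
  have Q0: "Q0 = insert 0 Q" and Q_0: "0 \<notin> Q" by (auto simp: Q_def Q0_def)
  then have QQ0: "Q \<subseteq> Q0" and zero: "0 \<in> Q0" by auto
  have finQ: "finite Q" "finite Q0" by (simp_all add: Q_def Q0_def)
  obtain \<phi> where \<phi>: "bij_betw \<phi> Q Z"
    using ex_bij_betw_nat_finite_1[OF fin(1)] card Q_def by metis
  obtain \<psi> where \<psi>: "bij_betw \<psi> Q0 Y"
    using ex_bij_betw_nat_finite[OF fin(2)] card Q0_def atLeastLessThanSuc_atLeastAtMost by metis
  have Z: "Z = \<phi> ` Q" and Y: "Y = \<psi> ` Q0"
    using \<phi> \<psi> by (auto simp: bij_betw_def)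
  have inj: "inj_on \<phi> Q" "inj_on \<psi> Q0"
    using \<phi> \<psi> by (auto simp: bij_betw_def)
  note inj_iff = inj_on_eq_iff[OF inj(1)] inj_on_eq_iff[OF inj(2)]
  have ne: "\<phi> z \<noteq> \<psi> x" "\<psi> x \<noteq> \<phi> z" if "z \<in> Q" "x \<in> Q0" for x z
    using disj that unfolding Z Y by force+
  define blk where "blk z x y = {\<phi> z, \<psi> x, \<psi> y}" for z x y
  have comm: "blk z x y = blk z y x" for z x y by (auto simp: blk_def)
  have sub: "{\<psi> x, \<psi> y} \<subseteq> blk z' x' y' \<longleftrightarrow> x = x' \<and> y = y' \<or> x = y' \<and> y = x'"
    if "x \<in> Q0" "y \<in> Q0" "x \<noteq> y" "z' \<in> Q" "x' \<in> Q0" "y' \<in> Q0" for x y z' x' y'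
    using that ne inj_iff by (auto simp: blk_def)
  have sub': "{\<phi> z, \<psi> x} \<subseteq> blk z' x' y' \<longleftrightarrow> z = z' \<and> (x = x' \<or> x = y')"
    if "z \<in> Q" "x \<in> Q0" "z' \<in> Q" "x' \<in> Q0" "y' \<in> Q0" for x z z' x' y'
    using that ne inj_iff by (auto simp: blk_def)
  have blk_eq: "blk z x y = blk z' x' y' \<longleftrightarrow> z = z' \<and> (x = x' \<and> y = y' \<or> x = y' \<and> y = x')"
    if "z \<in> Q" "x \<in> Q0" "y \<in> Q0" "x \<noteq> y" "z' \<in> Q" "x' \<in> Q0" "y' \<in> Q0" for z x y z' x' y'
  proof
    assume eq: "blk z x y = blk z' x' y'"
    then have "{\<psi> x, \<psi> y} \<subseteq> blk z' x' y'" "{\<phi> z, \<psi> x} \<subseteq> blk z' x' y'" by (auto simp: blk_def)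
    then show "z = z' \<and> (x = x' \<and> y = y' \<or> x = y' \<and> y = x')"
      using that sub[OF that(2-7)] sub'[OF that(1,2,5-7)] by blast
  qed (auto simp: blk_def)
  have BB: "BB = {blk z x y |z x y. z \<in> Q \<and> x \<in> Q0 \<and> y \<in> Q0 \<and> x \<noteq> y}"
    unfolding BB blk_def Z Y using inj_iff(2) by blast
  have exact_iff: "S \<in> exact_systems BB P \<longleftrightarrow> S \<subseteq> BB
      \<and> (\<forall>x\<in>Q0. \<forall>y\<in>Q0. x \<noteq> y \<longrightarrow> (\<exists>!z. z \<in> Q \<and> blk z x y \<in> S))
      \<and> (\<forall>z\<in>Q. \<forall>x\<in>Q0. \<exists>!y. y \<in> Q0 - {x} \<and> blk z x y \<in> S)" for S
  proof (cases "S \<subseteq> BB")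
    case True
    have transfer: "(\<exists>!b. b \<in> S \<and> p \<subseteq> b) \<longleftrightarrow> (\<exists>!t. t \<in> X \<and> g t \<in> S)"
      if "\<And>b. b \<in> S \<and> p \<subseteq> b \<longleftrightarrow> b \<in> S \<and> b \<in> g ` X" "inj_on g X" for p g X
      unfolding that(1) using inj_onD[OF that(2)] by (smt (verit) imageE imageI)
    have 1: "(\<exists>!b. b \<in> S \<and> {\<psi> x, \<psi> y} \<subseteq> b) \<longleftrightarrow> (\<exists>!z. z \<in> Q \<and> blk z x y \<in> S)"
      if "x \<in> Q0" "y \<in> Q0" "x \<noteq> y" for x y
    proof (rule transfer)
      show "inj_on (\<lambda>z. blk z x y) Q" using that by (auto intro!: inj_onI simp: blk_eq)
      show "b \<in> S \<and> {\<psi> x, \<psi> y} \<subseteq> b \<longleftrightarrow> b \<in> S \<and> b \<in> (\<lambda>z. blk z x y) ` Q" for b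
      proof (cases "b \<in> S")
        case True
        with \<open>S \<subseteq> BB\<close> obtain z' x' y' where "b = blk z' x' y'" "z' \<in> Q" "x' \<in> Q0" "y' \<in> Q0" "x' \<noteq> y'"
          unfolding BB by blast
        with that True show ?thesis
          by (auto simp: sub blk_eq image_iff simp del: insert_subset)
      qed simp
    qed
    have 2: "(\<exists>!b. b \<in> S \<and> {\<phi> z, \<psi> x} \<subseteq> b) \<longleftrightarrow> (\<exists>!y. y \<in> Q0 - {x} \<and> blk z x y \<in> S)"
      if "z \<in> Q" "x \<in> Q0" for z x
    proof (rule transfer)
      show "inj_on (\<lambda>y. blk z x y) (Q0 - {x})" using that by (auto intro!: inj_onI simp: blk_eq)
      show "b \<in> S \<and> {\<phi> z, \<psi> x} \<subseteq> b \<longleftrightarrow> b \<in> S \<and> b \<in> (\<lambda>y. blk z x y) ` (Q0 - {x})" for b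
      proof (cases "b \<in> S")
        case True
        with \<open>S \<subseteq> BB\<close> obtain z' x' y' where "b = blk z' x' y'" "z' \<in> Q" "x' \<in> Q0" "y' \<in> Q0" "x' \<noteq> y'"
          unfolding BB by blast
        with that True show ?thesis
          by (auto simp: sub' blk_eq image_iff simp del: insert_subset)
      qed simp
    qed
    have "(\<forall>p\<in>P. \<Phi> p) \<longleftrightarrow> (\<forall>x\<in>Q0. \<forall>y\<in>Q0. x \<noteq> y \<longrightarrow> \<Phi> {\<psi> x, \<psi> y}) \<and> (\<forall>z\<in>Q. \<forall>x\<in>Q0. \<Phi> {\<phi> z, \<psi> x})" for \<Phi>
      unfolding P Z Y using inj_iff(2) by (auto simp: ball_Un)
    with True show ?thesis
      by (simp add: exact_systems_def 1 2 del: insert_subset Diff_iff)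
  next
    case False
    then show ?thesis by (simp add: exact_systems_def)
  qed
  define SL where "SL = {f \<in> latin_squares u. \<forall>x y. f x y = f y x}"
  define g where "g f x y = (if x = 0 then f y y else if y = 0 then f x x else f x y)" for f :: "nat \<Rightarrow> nat \<Rightarrow> nat" and x y
  define F where "F f = {blk (g f x y) x y |x y. x \<in> Q0 \<and> y \<in> Q0 \<and> x \<noteq> y}" for f
  have row: "bij_betw (f x) Q Q" if "f \<in> SL" "x \<in> Q" for f x
    using that unfolding SL_def latin_squares_def Q_def by simp
  have latin: "f x y \<in> Q" if "f \<in> SL" "x \<in> Q" "y \<in> Q" for f x y
    using row[OF that(1,2)] that(3) by (auto dest: bij_betwE)
  have sym: "f x y = f y x" if "f \<in> SL" for f x y
    using that unfolding SL_def by blast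
  \<comment> \<open>The only use of the parity assumption: the edges at infinity carry the diagonal
    entries, which must therefore be all labels, each once.\<close>
  have diag: "bij_betw (\<lambda>x. f x x) Q Q" if "f \<in> SL" for f
    using symmetric_latin_diagonal[of f u] that u by (auto simp: SL_def Q_def bij_betw_def)
  have gQ: "g f x y \<in> Q" if "f \<in> SL" "x \<in> Q0" "y \<in> Q0" "x \<noteq> y" for f x y
    using that latin by (auto simp: g_def Q0)
  have gsym: "g f x y = g f y x" if "f \<in> SL" for f x y
    using sym[OF that] by (auto simp: g_def)
  have F_iff: "blk z x y \<in> F f \<longleftrightarrow> g f x y = z" if "f \<in> SL" "z \<in> Q" "x \<in> Q0" "y \<in> Q0" "x \<noteq> y" for f x y z
  proof
    assume "blk z x y \<in> F f"
    then obtain x' y' where xy: "x' \<in> Q0" "y' \<in> Q0" "x' \<noteq> y'" "blk z x y = blk (g f x' y') x' y'"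
      unfolding F_def by blast
    then show "g f x y = z"
      using that gQ[OF that(1) xy(1-3)] gsym[OF that(1)] by (auto simp: blk_eq)
  qed (use that in \<open>auto simp: F_def\<close>)
  have "bij_betw F SL (exact_systems BB P)"
    unfolding bij_betw_def
  proof
    show "inj_on F SL"
    proof (rule inj_onI)
      fix f h assume fh: "f \<in> SL" "h \<in> SL" "F f = F h"
      have geq: "g f x y = g h x y" if "x \<in> Q0" "y \<in> Q0" "x \<noteq> y" for x y
        using F_iff[OF fh(1) gQ[OF fh(1) that] that] F_iff[OF fh(2) gQ[OF fh(1) that] that] fh(3) by simp
      have "f x y = h x y" if "x \<in> Q" "y \<in> Q" for x y
      proof (cases "x = y")
        case True
        then show ?thesis
          using geq[of 0 y] zero QQ0 that Q_0 by (auto simp: g_def)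
      next
        case False
        have "x \<noteq> 0" "y \<noteq> 0" using that Q_0 by metis+
        then show ?thesis
          using geq[of x y] QQ0 that False by (auto simp: g_def)
      qed
      moreover have "f x y = h x y" if "x \<notin> Q \<or> y \<notin> Q" for x y
        using that fh(1,2) by (auto simp: SL_def latin_squares_def Q_def)
      ultimately show "f = h" by blast
    qed
    show "F ` SL = exact_systems BB P"
    proof (intro subset_antisym subsetI)
      fix S assume "S \<in> F ` SL"
      then obtain f where f: "f \<in> SL" "S = F f" by blast
      show "S \<in> exact_systems BB P"
        unfolding exact_iff f(2)
      proof (intro conjI ballI impI)
        show "F f \<subseteq> BB"
          using gQ[OF f(1)] unfolding F_def BB by blast
        show "\<exists>!z. z \<in> Q \<and> blk z x y \<in> F f" if "x \<in> Q0" "y \<in> Q0" "x \<noteq> y" for x y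
        proof -
          have "z \<in> Q \<and> blk z x y \<in> F f \<longleftrightarrow> z = g f x y" for z
            using F_iff[OF f(1) _ that, of z] gQ[OF f(1) that] by auto
          then show ?thesis by simp
        qed
        show "\<exists>!y. y \<in> Q0 - {x} \<and> blk z x y \<in> F f" if z: "z \<in> Q" and x: "x \<in> Q0" for z x
        proof -
          have *: "y \<in> Q0 - {x} \<and> blk z x y \<in> F f \<longleftrightarrow> y \<in> Q0 - {x} \<and> g f x y = z" for y
            using F_iff[OF f(1) z x, of y] by auto
          show ?thesis
          proof (cases "x = 0")
            case True
            have "y \<in> Q0 - {x} \<and> g f x y = z \<longleftrightarrow> y \<in> Q \<and> f y y = z" for y
              using True Q_0 by (auto simp: g_def Q0)
            then show ?thesis
              unfolding * using bij_betw_ex1[OF diag[OF f(1)] z] by simp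
          next
            case False
            then have xQ: "x \<in> Q" using x by (simp add: Q0)
            \<comment> \<open>At a finite vertex \<open>x\<close> the column holding
              \<open>z\<close> names the neighbour along the edge of colour \<open>z\<close>, except
              that the diagonal column stands for the neighbour at infinity.\<close>
            let ?\<sigma> = "\<lambda>t. if t = x then 0 else t"
            obtain t where t: "\<And>s. s \<in> Q \<and> f x s = z \<longleftrightarrow> s = t"
              using bij_betw_ex1[OF row[OF f(1) xQ] z] by (metis (no_types, lifting))
            have "y \<in> Q0 - {x} \<and> g f x y = z \<longleftrightarrow> (\<exists>t. t \<in> Q \<and> f x t = z \<and> y = ?\<sigma> t)" for y
              using False xQ Q_0 by (auto simp: g_def Q0)
            then show ?thesis
              unfolding * conj_assoc[symmetric] t by simp
          qed
        qed
      qed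
    next
      fix S assume "S \<in> exact_systems BB P"
      then have S: "S \<subseteq> BB"
        and z: "\<And>x y. x \<in> Q0 \<Longrightarrow> y \<in> Q0 \<Longrightarrow> x \<noteq> y \<Longrightarrow> \<exists>!z. z \<in> Q \<and> blk z x y \<in> S"
        and y: "\<And>z x. z \<in> Q \<Longrightarrow> x \<in> Q0 \<Longrightarrow> \<exists>!y. y \<in> Q0 - {x} \<and> blk z x y \<in> S"
        unfolding exact_iff by auto
      define h where "h x y = (THE z. z \<in> Q \<and> blk z x y \<in> S)" for x y
      \<comment> \<open>\<open>h\<close> colours the edges; the loop missing at \<open>x\<close> is
        replaced by the edge from \<open>x\<close> to 0, the point at infinity.\<close>
      define f where "f x y = (if x \<in> Q \<and> y \<in> Q then h x (if y = x then 0 else y) else 0)" for x y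
      have h: "h x y \<in> Q" "blk (h x y) x y \<in> S" if "x \<in> Q0" "y \<in> Q0" "x \<noteq> y" for x y
        using theI'[OF z[OF that]] by (auto simp: h_def)
      have h_eq: "h x y = z" if "x \<in> Q0" "y \<in> Q0" "x \<noteq> y" "z \<in> Q" "blk z x y \<in> S" for x y z
        using the1_equality[OF z[OF that(1-3)]] that by (auto simp: h_def)
      have h_sym: "h x y = h y x" for x y
        unfolding h_def comm[of _ x y] ..
      have h_inj: "s = t" if "x \<in> Q0" "s \<in> Q0" "t \<in> Q0" "x \<noteq> s" "x \<noteq> t" "h x s = h x t" for x s t
      proof -
        have "blk (h x t) x s \<in> S" using h(2)[of x s] that by simp
        with y[OF h(1)[of x t] that(1)] h(2)[of x t] that show "s = t" by blast
      qed
      have f_sym: "f x y = f y x" for x y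
        using h_sym by (simp add: f_def)
      have rowf: "bij_betw (f x) Q Q" if x: "x \<in> Q" for x
      proof (rule bij_betw_endo)
        have x0: "x \<noteq> 0" using x Q_0 by metis
        show "f x ` Q \<subseteq> Q"
          using x x0 h(1) by (auto simp: f_def Q0)
        show "inj_on (f x) Q"
        proof (rule inj_onI)
          fix s t assume st: "s \<in> Q" "t \<in> Q" "f x s = f x t"
          have "(if s = x then 0 else s) = (if t = x then 0 else t)"
            by (rule h_inj[of x]) (use st x x0 in \<open>auto simp: f_def Q0 split: if_splits\<close>)
          then show "s = t"
            using st Q_0 by (auto split: if_splits)
        qed
      qed (rule finQ)
      then have fl: "f \<in> SL"
        unfolding SL_def latin_squares_def Q_def[symmetric]
        using f_sym by (auto simp: f_sym[of _ x for x]) (auto simp: f_def)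
      have gh: "g f x y = h x y" if "x \<in> Q0" "y \<in> Q0" "x \<noteq> y" for x y
        using that h_sym Q_0 by (auto simp: g_def f_def Q0)
      have "F f = S"
      proof
        show "F f \<subseteq> S" using gh h(2) by (auto simp: F_def)
        show "S \<subseteq> F f"
        proof
          fix b assume "b \<in> S"
          then obtain z x y where b: "b = blk z x y" "z \<in> Q" "x \<in> Q0" "y \<in> Q0" "x \<noteq> y"
            using S unfolding BB by blast
          then show "b \<in> F f"
            using F_iff[OF fl b(2-5)] h_eq[OF b(3-5,2)] gh[OF b(3-5)] \<open>b \<in> S\<close> by simp
        qed
      qed
      with fl show "S \<in> F ` SL" by blast
    qed
  qed
  from bij_betw_same_card[OF this] show ?thesis
    by (simp add: Defs.Pi_def SL_def)
qed

section \<open>Triple systems compatible with a colouring\<close>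

lemma gf2_vec_add_cancel [simp]: "u + (u + v) = (v :: 'a \<Rightarrow> bit)" "v + u + u = v"
  by (simp_all only: add.assoc[symmetric] gf2_vec_add_self add_0) (simp only: add.assoc gf2_vec_add_self add_0_right)

lemma gf2_vec_add_eq_left_iff [simp]: "u + v = u \<longleftrightarrow> v = (0 :: 'a \<Rightarrow> bit)" "v + u = u \<longleftrightarrow> v = 0"
  by (metis add_0_right add_left_cancel, metis add_0 add_right_cancel)

definition gf2_lines :: "('a \<Rightarrow> bit) set \<Rightarrow> ('a \<Rightarrow> bit) set set" where
  "gf2_lines V = (\<lambda>(a, b). {a, b, a + b}) ` {(a, b). a \<in> V - {0} \<and> b \<in> V - {0} \<and> a \<noteq> b}"

text \<open>Any two points of a line determine the third, so each line comes from 3 * 2 ordered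
  pairs of distinct nonzero vectors. This is the origin of the exponent of
  \<open>Lambda\<close>.\<close>

lemma card_gf2_lines:
  assumes "finite V" "0 \<in> V" and add: "\<And>u v. u \<in> V \<Longrightarrow> v \<in> V \<Longrightarrow> u + v \<in> V"
  shows "card (gf2_lines V) = (card V - 1) * (card V - 2) div 6"
proof -
  let ?f = "\<lambda>(a, b). {a, b, a + b :: 'a \<Rightarrow> bit}"
  define D where "D = {(a, b). a \<in> V - {0} \<and> b \<in> V - {0} \<and> a \<noteq> b}"
  have D: "D = (SIGMA a:V - {0}. V - {0} - {a})"
    by (auto simp: D_def)
  then have fin: "finite D" using assms by simp
  have "card D = (card V - 1) * (card V - 2)"
    unfolding D using assms by (simp add: card_Diff_singleton flip: numeral_2_eq_2)
  moreover have "card {p \<in> D. ?f p = L} = 6" if LD: "L \<in> ?f ` D" for L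
  proof -
    obtain a b where ab: "(a, b) \<in> D" and L: "L = {a, b, a + b}"
      using LD by auto
    define d where "d = a + b"
    have d: "a + b = d" "b + a = d" "a + d = b" "d + a = b" "b + d = a" "d + b = a"
      by (simp_all add: d_def ac_simps)
    have ne: "a \<noteq> 0" "b \<noteq> 0" "d \<noteq> 0" "a \<noteq> b" "a \<noteq> d" "b \<noteq> d" and "a \<in> V" "b \<in> V" "d \<in> V"
      using ab add by (auto simp: D_def d_def gf2_vec_add_eq_0_iff eq_commute[of _ "a + b"])
    have "{p \<in> D. ?f p = L} = {(a, b), (b, a), (a, d), (d, a), (b, d), (d, b)}"
    proof (intro subset_antisym subrelI)
      fix x y assume "(x, y) \<in> {p \<in> D. ?f p = L}"
      then have "{x, y, x + y} = {a, b, d}" "x \<noteq> y"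
        unfolding L d(1) by (auto simp: D_def)
      then have "x \<in> {a, b, d}" "y \<in> {a, b, d}" "x \<noteq> y" by blast+
      then show "(x, y) \<in> {(a, b), (b, a), (a, d), (d, a), (b, d), (d, b)}" by auto
    next
      fix x y assume "(x, y) \<in> {(a, b), (b, a), (a, d), (d, a), (b, d), (d, b)}"
      with \<open>a \<in> V\<close> \<open>b \<in> V\<close> \<open>d \<in> V\<close> ne show "(x, y) \<in> {p \<in> D. ?f p = L}"
        unfolding L d(1) by (auto simp: D_def d insert_commute)
    qed
    then show ?thesis
      using ne by simp
  qed
  moreover have "card D = (\<Sum>L\<in>?f ` D. card {p \<in> D. ?f p = L})"
    using sum.image_gen[OF fin, of "\<lambda>_. 1::nat" ?f] by simp
  ultimately have "(card V - 1) * (card V - 2) = card (?f ` D) * 6"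
    by simp
  then show ?thesis
    unfolding gf2_lines_def D_def[symmetric] by simp
qed

text \<open>The class of colour 0 has q - 1 points because \<open>X\<close> leaves out the extra
  point, which also has colour 0.\<close>

context
  fixes X :: "nat set" and V :: "('a \<Rightarrow> bit) set" and c :: "nat \<Rightarrow> 'a \<Rightarrow> bit" and q :: nat
  assumes finX: "finite X" and finV: "finite V" and V0: "0 \<in> V"
    and Vadd: "\<And>u v. u \<in> V \<Longrightarrow> v \<in> V \<Longrightarrow> u + v \<in> V"
    and cV: "\<And>x. x \<in> X \<Longrightarrow> c x \<in> V"
    and card_fiber: "\<And>v. v \<in> V \<Longrightarrow> card {x \<in> X. c x = v} = (if v = 0 then q - 1 else q)"
    and q: "q > 0"
begin

definition "coloured_blocks = {b. b \<subseteq> X \<and> card b = 3 \<and> sum c b = 0}"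
definition "point_pairs = {p. p \<subseteq> X \<and> card p = 2}"
text \<open>The sum of the two colours is the colour forced on the third point of a block, so this
  is the colour set of every admissible block through \<open>p\<close>.\<close>

definition "pair_type p = insert (sum c p) (c ` p)"
definition "fiber v = {x \<in> X. c x = v}"

lemma finite_fiber: "finite (fiber v)"
  using finX by (simp add: fiber_def)

lemma coloured_blockE:
  assumes "b \<in> coloured_blocks" "x \<in> b" "y \<in> b" "x \<noteq> y"
  obtains z where "b = {x, y, z}" "z \<noteq> x" "z \<noteq> y" "c z = c x + c y" "x \<in> X" "y \<in> X" "z \<in> X"
proof -
  have b: "b \<subseteq> X" "card b = 3" "sum c b = 0"
    using assms by (auto simp: coloured_blocks_def)
  have "card (b - {x, y}) = 1"
    using b assms by (subst card_Diff_subset) auto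
  then obtain z where z: "b - {x, y} = {z}"
    by (auto simp: card_1_singleton_iff)
  then have bz: "b = {x, y, z}" "z \<noteq> x" "z \<noteq> y" using assms by auto
  with b(3) \<open>x \<noteq> y\<close> have "c x + c y + c z = 0"
    by (simp add: add.assoc)
  then have "c z = c x + c y"
    by (simp only: gf2_vec_add_eq_0_iff)
  then show thesis
    using that bz b(1) by auto
qed

lemma coloured_blockI:
  assumes "x \<in> X" "y \<in> X" "z \<in> X" "x \<noteq> y" "x \<noteq> z" "y \<noteq> z" "c x + c y = c z"
  shows "{x, y, z} \<in> coloured_blocks"
  using assms by (simp add: coloured_blocks_def add.assoc[symmetric])

lemma pairE:
  assumes "p \<in> point_pairs"
  obtains x y where "p = {x, y}" "x \<noteq> y" "x \<in> X" "y \<in> X" "pair_type p = {c x, c y, c x + c y}"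
  using assms by (auto simp: point_pairs_def card_2_iff pair_type_def insert_commute)

lemma pairI:
  assumes "x \<in> X" "y \<in> X" "x \<noteq> y"
  shows "{x, y} \<in> point_pairs" "pair_type {x, y} = {c x, c y, c x + c y}"
  using assms by (auto simp: point_pairs_def pair_type_def)

lemma card_type_zero:
  "card (exact_systems {b \<in> coloured_blocks. c ` b = {0}} {p \<in> point_pairs. pair_type p = {0}}) = Psi (q - 1)"
proof -
  have "{b \<in> coloured_blocks. c ` b = {0}} = {b. b \<subseteq> fiber 0 \<and> card b = 3}"
    by (auto simp: coloured_blocks_def fiber_def image_subset_iff subset_iff image_constant_conv intro!: sum.neutral)
  moreover have "{p \<in> point_pairs. pair_type p = {0}} = {p. p \<subseteq> fiber 0 \<and> card p = 2}"
  proof (intro subset_antisym subsetI)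
    fix p assume "p \<in> {p \<in> point_pairs. pair_type p = {0}}"
    then show "p \<in> {p. p \<subseteq> fiber 0 \<and> card p = 2}"
      by (auto simp: point_pairs_def fiber_def pair_type_def)
  next
    fix p assume "p \<in> {p. p \<subseteq> fiber 0 \<and> card p = 2}"
    then show "p \<in> {p \<in> point_pairs. pair_type p = {0}}"
      by (auto simp: card_2_iff fiber_def intro!: pairI simp: pairI(2))
  qed
  moreover have "card (fiber 0) = q - 1"
    using card_fiber[OF V0] by (simp add: fiber_def)
  ultimately show ?thesis
    using card_exact_systems_STS[OF finite_fiber, of 0] by simp
qed

text \<open>Two points of colour \<open>a\<close> force a third point of colour 0. So the points of
  \<open>fiber 0\<close> label the factors of a one-factorization of the complete graph on
  \<open>fiber a\<close>.\<close>

lemma card_type_pair: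
  assumes a: "a \<in> V" "a \<noteq> 0" and "odd (q - 1) \<or> q - 1 = 0"
  shows "card (exact_systems {b \<in> coloured_blocks. c ` b = {0, a}} {p \<in> point_pairs. pair_type p = {0, a}}) = Defs.Pi (q - 1)"
proof (rule card_exact_systems_one_factor)
  show "card (fiber 0) = q - 1" "card (fiber a) = Suc (q - 1)"
    using card_fiber[OF V0] card_fiber[OF a(1)] a(2) q by (auto simp: fiber_def)
  show "fiber 0 \<inter> fiber a = {}"
    using a by (auto simp: fiber_def)
  show "{b \<in> coloured_blocks. c ` b = {0, a}} = {{z, x, y} |z x y. z \<in> fiber 0 \<and> x \<in> fiber a \<and> y \<in> fiber a \<and> x \<noteq> y}"
  proof (intro subset_antisym subsetI)
    fix b assume b: "b \<in> {b \<in> coloured_blocks. c ` b = {0, a}}"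
    then have bc: "b \<in> coloured_blocks" and "0 \<in> c ` b" "a \<in> c ` b" by simp_all
    then obtain z x where zx: "z \<in> b" "c z = 0" "x \<in> b" "c x = a"
      by (metis imageE)
    then have "z \<noteq> x" using a by auto
    then obtain y where "b = {z, x, y}" "y \<noteq> x" "c y = c z + c x" "z \<in> X" "x \<in> X" "y \<in> X"
      by (rule coloured_blockE[OF bc zx(1,3)])
    with zx show "b \<in> {{z, x, y} |z x y. z \<in> fiber 0 \<and> x \<in> fiber a \<and> y \<in> fiber a \<and> x \<noteq> y}"
      by (auto simp: fiber_def)
  next
    fix b assume "b \<in> {{z, x, y} |z x y. z \<in> fiber 0 \<and> x \<in> fiber a \<and> y \<in> fiber a \<and> x \<noteq> y}"
    then show "b \<in> {b \<in> coloured_blocks. c ` b = {0, a}}"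
      using a by (auto simp: fiber_def intro!: coloured_blockI)
  qed
  show "{p \<in> point_pairs. pair_type p = {0, a}} = (\<lambda>(x, y). {x, y}) ` ({(x, y) \<in> fiber a \<times> fiber a. x \<noteq> y} \<union> fiber 0 \<times> fiber a)"
    (is "?L = ?R")
  proof (intro subset_antisym subsetI)
    fix p assume "p \<in> ?L"
    then have pp: "p \<in> point_pairs" and pt: "pair_type p = {0, a}" by simp_all
    obtain x y where p: "p = {x, y}" "x \<noteq> y" "x \<in> X" "y \<in> X" "{0, a} = {c x, c y, c x + c y}"
      by (rule pairE[OF pp, unfolded pt])
    then have "c x \<in> {0, a}" "c y \<in> {0, a}" "c x \<noteq> 0 \<or> c y \<noteq> 0"
      using a by auto
    then consider "c x = a" "c y = a" | "c x = 0" "c y = a" | "c x = a" "c y = 0"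
      by auto
    then show "p \<in> ?R"
    proof cases
      case 1
      then show ?thesis using p by (auto simp: fiber_def intro!: image_eqI[of _ _ "(x, y)"])
    next
      case 2
      then show ?thesis using p by (auto simp: fiber_def intro!: image_eqI[of _ _ "(x, y)"])
    next
      case 3
      then show ?thesis using p by (auto simp: fiber_def insert_commute intro!: image_eqI[of _ _ "(y, x)"])
    qed
  next
    fix p assume "p \<in> ?R"
    then obtain x y where p: "p = {x, y}" "x \<in> X" "y \<in> X" "x \<noteq> y" "c x = a \<and> c y = a \<or> c x = 0 \<and> c y = a"
      using a by (auto simp: fiber_def)
    from p(5) have "pair_type p = {0, a}"
      unfolding p(1) pairI(2)[OF p(2-4)] by (elim disjE conjE) (simp_all add: insert_commute)
    with pairI(1)[OF p(2-4)] show "p \<in> ?L"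
      by (simp add: p(1))
  qed
qed (use assms finite_fiber in auto)

text \<open>A block of this type meets each of the three fibres once, and two of the colours
  determine the third, so the fibres act as rows, columns and symbols.\<close>

lemma card_type_line:
  assumes "L \<in> gf2_lines V"
  shows "card (exact_systems {b \<in> coloured_blocks. c ` b = L} {p \<in> point_pairs. pair_type p = L}) = Lambda q"
proof -
  obtain a b where ab: "a \<in> V" "b \<in> V" "a \<noteq> 0" "b \<noteq> 0" "a \<noteq> b" "L = {a, b, a + b}"
    using assms by (auto simp: gf2_lines_def)
  define d where "d = a + b"
  have L: "L = {a, b, d}" using ab by (simp add: d_def)
  have d: "a + b = d" "b + a = d" "a + d = b" "d + a = b" "b + d = a" "d + b = a"
    by (simp_all add: d_def ac_simps)
  have ne: "a \<noteq> 0" "b \<noteq> 0" "d \<noteq> 0" "a \<noteq> b" "a \<noteq> d" "b \<noteq> d" "d \<in> V"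
    using ab Vadd by (auto simp: d_def gf2_vec_add_eq_0_iff eq_commute[of _ "a + b"])
  show ?thesis
  proof (rule card_exact_systems_latin)
    show "card (fiber a) = q" "card (fiber b) = q" "card (fiber d) = q"
      using card_fiber ab ne by (auto simp: fiber_def)
    show "fiber a \<inter> fiber b = {}" "fiber a \<inter> fiber d = {}" "fiber b \<inter> fiber d = {}"
      using ne by (auto simp: fiber_def)
    show "{e \<in> coloured_blocks. c ` e = L} = {{x, y, z} |x y z. x \<in> fiber a \<and> y \<in> fiber b \<and> z \<in> fiber d}"
    proof (intro subset_antisym subsetI)
      fix e assume e: "e \<in> {e \<in> coloured_blocks. c ` e = L}"
      then have ec: "e \<in> coloured_blocks" and "a \<in> c ` e" "b \<in> c ` e" by (simp_all add: L)
      then obtain x y where xy: "x \<in> e" "c x = a" "y \<in> e" "c y = b"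
        by (metis imageE)
      then have "x \<noteq> y" using ne by auto
      then obtain z where "e = {x, y, z}" "c z = c x + c y" "x \<in> X" "y \<in> X" "z \<in> X"
        by (rule coloured_blockE[OF ec xy(1,3)])
      with xy show "e \<in> {{x, y, z} |x y z. x \<in> fiber a \<and> y \<in> fiber b \<and> z \<in> fiber d}"
        by (auto simp: fiber_def d)
    next
      fix e assume "e \<in> {{x, y, z} |x y z. x \<in> fiber a \<and> y \<in> fiber b \<and> z \<in> fiber d}"
      then show "e \<in> {e \<in> coloured_blocks. c ` e = L}"
        using ne d(1) by (auto simp: fiber_def L intro!: coloured_blockI)
    qed
    show "{p \<in> point_pairs. pair_type p = L} = (\<lambda>(x, y). {x, y}) ` (fiber a \<times> fiber b \<union> fiber a \<times> fiber d \<union> fiber b \<times> fiber d)"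
      (is "?L = ?R")
    proof (intro subset_antisym subsetI)
      fix p assume "p \<in> ?L"
      then have pp: "p \<in> point_pairs" and pt: "pair_type p = {a, b, d}" by (simp_all add: L)
      obtain x y where p: "p = {x, y}" "x \<noteq> y" "x \<in> X" "y \<in> X" "{a, b, d} = {c x, c y, c x + c y}"
        by (rule pairE[OF pp, unfolded pt])
      then have "c x \<in> {a, b, d}" "c y \<in> {a, b, d}" by auto
      \<comment> \<open>Equal colours would sum to 0, which does not lie on the line.\<close>
      moreover have "c x \<noteq> c y"
        using p(5) ne by (metis gf2_vec_add_self insertCI insertE singletonD)
      ultimately have "(x, y) \<in> fiber a \<times> fiber b \<union> fiber a \<times> fiber d \<union> fiber b \<times> fiber d \<or>
          (y, x) \<in> fiber a \<times> fiber b \<union> fiber a \<times> fiber d \<union> fiber b \<times> fiber d"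
        using p(3,4) by (auto simp: fiber_def)
      then show "p \<in> ?R"
        using p(1) by (auto simp: insert_commute)
    next
      fix p assume "p \<in> ?R"
      then obtain x y where p: "p = {x, y}" "x \<in> X" "y \<in> X"
        and col: "c x = a \<and> c y = b \<or> c x = a \<and> c y = d \<or> c x = b \<and> c y = d"
        by (auto simp: fiber_def)
      then have "x \<noteq> y" using ne by auto
      from col have "pair_type p = L"
        unfolding p(1) pairI(2)[OF p(2,3) \<open>x \<noteq> y\<close>] L
        by (elim disjE conjE) (simp_all add: d insert_commute)
      with pairI(1)[OF p(2,3) \<open>x \<noteq> y\<close>] show "p \<in> ?L"
        by (simp add: p(1))
    qed
  qed (rule finite_fiber)+
qed

lemma card_coloured_systems:
  "card {S. S \<in> exact_systems {b. b \<subseteq> X \<and> card b = 3} {p. p \<subseteq> X \<and> card p = 2} \<and> (\<forall>b\<in>S. sum c b = 0)}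
    = Psi (q - 1) * Defs.Pi (q - 1) ^ (card V - 1) * Lambda q ^ ((card V - 1) * (card V - 2) div 6)"
proof -
  define T where "T = {{0}} \<union> (\<lambda>a. {0, a}) ` (V - {0}) \<union> gf2_lines V"
  let ?N = "\<lambda>\<tau>. card (exact_systems {b \<in> coloured_blocks. c ` b = \<tau>} {p \<in> point_pairs. pair_type p = \<tau>})"
  \<comment> \<open>Two colours are both 0, or span a one-dimensional space, or span a line; these
    are the three families of types.\<close>
  have T: "{a, b, a + b} \<in> T" if "a \<in> V" "b \<in> V" for a b
  proof -
    consider "a = 0" "b = 0" | "a = 0" "b \<noteq> 0" | "b = 0" "a \<noteq> 0" | "a = b" "a \<noteq> 0" | "a \<noteq> 0" "b \<noteq> 0" "a \<noteq> b" by auto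
    then show ?thesis
    proof cases
      case 5
      then show ?thesis using that by (auto simp: T_def gf2_lines_def)
    qed (use that in \<open>auto simp: T_def insert_commute\<close>)
  qed
  have finL: "finite (gf2_lines V)"
  proof -
    have "gf2_lines V \<subseteq> Pow V"
      using Vadd by (auto simp: gf2_lines_def)
    then show ?thesis using finV by (auto intro: finite_subset)
  qed
  have "card (exact_systems coloured_blocks point_pairs) = (\<Prod>\<tau>\<in>T. ?N \<tau>)"
  proof (rule card_exact_systems_prod)
    show "finite T" using finV finL by (simp add: T_def)
    show "pair_type p \<in> T" if "p \<in> point_pairs" for p
      using that cV T by (auto elim!: pairE)
    have key: "pair_type {x, y} = c ` b" if "b \<in> coloured_blocks" "x \<in> b" "y \<in> b" "x \<noteq> y" for b x y
      using that by (auto elim!: coloured_blockE[of b x y] simp: pairI(2))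
    show ut: "pair_type p = c ` b" if "p \<in> point_pairs" "b \<in> coloured_blocks" "p \<subseteq> b" for p b
      using that key[of b] by (auto elim!: pairE)
    show "c ` b \<in> T" if "b \<in> coloured_blocks" for b
    proof -
      have "card b = 3" "b \<subseteq> X" using that by (auto simp: coloured_blocks_def)
      then obtain x y where xy: "x \<in> b" "y \<in> b" "x \<noteq> y" "x \<in> X" "y \<in> X"
        by (auto simp: card_3_iff)
      with key[OF that xy(1-3)] T[of "c x" "c y"] cV show ?thesis
        by (simp add: pairI(2))
    qed
  qed
  also have "\<dots> = ?N {0} * (\<Prod>\<tau>\<in>(\<lambda>a. {0, a}) ` (V - {0}). ?N \<tau>) * (\<Prod>\<tau>\<in>gf2_lines V. ?N \<tau>)"
  proof -
    let ?B = "(\<lambda>a. {0, a}) ` (V - {0})"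
    \<comment> \<open>The three families are disjoint because their members have 1, 2 and 3
      elements.\<close>
    have 3: "card \<tau> = 3" if "\<tau> \<in> gf2_lines V" for \<tau>
      using that by (auto simp: gf2_lines_def eq_commute[of _ "a + b" for a b])
    have "card {0, a} = 2" if "a \<noteq> 0" for a :: "'a \<Rightarrow> bit"
      using that by simp
    then have 2: "card \<tau> = 2" if "\<tau> \<in> ?B" for \<tau>
      using that by blast
    have disjI: "M \<inter> N = {}" if "\<And>\<tau>. \<tau> \<in> M \<Longrightarrow> card \<tau> \<noteq> k" "\<And>\<tau>. \<tau> \<in> N \<Longrightarrow> card \<tau> = k"
      for M N :: "('a \<Rightarrow> bit) set set" and k
      using that by blast
    have "{{0}} \<inter> ?B = {}"
    proof (rule disjI[where k = 2])
      show "card \<tau> \<noteq> 2" if "\<tau> \<in> {{0}}" for \<tau> :: "('a \<Rightarrow> bit) set"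
        using that by simp
    qed (rule 2)
    moreover have "({{0}} \<union> ?B) \<inter> gf2_lines V = {}"
    proof (rule disjI[where k = 3])
      fix \<tau> assume "\<tau> \<in> {{0}} \<union> ?B"
      then have "\<tau> = {0} \<or> \<tau> \<in> ?B" by blast
      then show "card \<tau> \<noteq> 3" using 2[of \<tau>] by (elim disjE) simp_all
    qed (rule 3)
    ultimately show ?thesis
      unfolding T_def using finV finL by (simp add: prod.union_disjoint del: Un_insert_left)
  qed
  also have "\<dots> = Psi (q - 1) * Defs.Pi (q - 1) ^ (card V - 1) * Lambda q ^ ((card V - 1) * (card V - 2) div 6)"
  proof (cases "odd (q - 1) \<or> q - 1 = 0")
    case True
    have "inj_on (\<lambda>a. {0, a}) (V - {0})"
      by (auto simp: inj_on_def doubleton_eq_iff)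
    then have "(\<Prod>\<tau>\<in>(\<lambda>a. {0, a}) ` (V - {0}). ?N \<tau>) = Defs.Pi (q - 1) ^ (card V - 1)"
      using True finV V0 by (simp add: prod.reindex card_type_pair card_Diff_singleton)
    moreover have "(\<Prod>\<tau>\<in>gf2_lines V. ?N \<tau>) = Lambda q ^ card (gf2_lines V)"
      by (simp add: card_type_line)
    ultimately show ?thesis
      by (simp add: card_type_zero card_gf2_lines[OF finV V0 Vadd])
  next
    case False
    then have "Psi (q - 1) = 0" by (intro Psi_even_eq_0) auto
    then show ?thesis by (simp add: card_type_zero)
  qed
  also have "exact_systems coloured_blocks point_pairs =
      {S. S \<in> exact_systems {b. b \<subseteq> X \<and> card b = 3} {p. p \<subseteq> X \<and> card p = 2} \<and> (\<forall>b\<in>S. sum c b = 0)}"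
    by (auto simp: exact_systems_def coloured_blocks_def point_pairs_def)
  finally show ?thesis .
qed

end

section \<open>Equitable colourings and independent tuples\<close>

definition equitable :: "nat \<Rightarrow> 'a set \<Rightarrow> 'b::zero set \<Rightarrow> ('a \<Rightarrow> 'b) set" where
  "equitable q X V = {c. (\<forall>x\<in>X. c x \<in> V) \<and> (\<forall>x. x \<notin> X \<longrightarrow> c x = 0) \<and> (\<forall>v\<in>V. card {x \<in> X. c x = v} = q)}"

text \<open>A multinomial coefficient with the denominator multiplied out. The induction picks the
  class of one colour and colours the rest equitably with the remaining ones.\<close>

lemma card_equitable:
  fixes V :: "'b::zero set" and X :: "'a set"
  assumes "finite V" "finite X" "card X = q * card V"
  shows "card (equitable q X V) * fact q ^ card V = fact (card X)"
  using assms
proof (induction V arbitrary: X rule: finite_induct)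
  case empty
  then have "equitable q X ({} :: 'b set) = {\<lambda>_. 0}"
    by (auto simp: equitable_def)
  with empty show ?case by simp
next
  case (insert v V)
  let ?Q = "{A. A \<subseteq> X \<and> card A = q}"
  have IH: "card (equitable q (X - A) V) * fact q ^ card V = fact (card X - q)" if "A \<in> ?Q" for A
  proof -
    have "card (X - A) = card X - q"
      using that finite_subset[OF _ insert.prems(1)] by (simp add: card_Diff_subset)
    with insert.IH[of "X - A"] insert show ?thesis by simp
  qed
  \<comment> \<open>An infinite set would have cardinality 0, contradicting the induction
    hypothesis, whose right side is a factorial.\<close>
  have fin: "finite (equitable q (X - A) V)" if "A \<in> ?Q" for A
  proof (rule card_ge_0_finite, rule ccontr)
    assume "\<not> card (equitable q (X - A) V) > 0"
    with IH[OF that] show False by simp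
  qed
  have "bij_betw (\<lambda>(A, c) x. if x \<in> A then v else c x) (SIGMA A:?Q. equitable q (X - A) V) (equitable q X (insert v V))"
  proof (rule bij_betwI[where g = "\<lambda>c. ({x \<in> X. c x = v}, \<lambda>x. if c x = v then 0 else c x)"])
    show "(\<lambda>(A, c) x. if x \<in> A then v else c x) \<in> (SIGMA A:?Q. equitable q (X - A) V) \<rightarrow> equitable q X (insert v V)"
    proof (clarify, rename_tac A c)
      fix A c assume A: "A \<subseteq> X" "q = card A" and c: "c \<in> equitable (card A) (X - A) V"
      have c': "c x \<in> V" if "x \<in> X" "x \<notin> A" for x
        using c that by (auto simp: equitable_def)
      have "{x \<in> X. (if x \<in> A then v else c x) = v} = A"
        using A c' insert.hyps by auto
      moreover have "{x \<in> X. (if x \<in> A then v else c x) = u} = {x \<in> X - A. c x = u}" if "u \<in> V" for u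
        using that insert.hyps by auto
      ultimately show "(\<lambda>x. if x \<in> A then v else c x) \<in> equitable (card A) X (insert v V)"
        using c A c' by (auto simp: equitable_def)
    qed
    show "(\<lambda>c. ({x \<in> X. c x = v}, \<lambda>x. if c x = v then 0 else c x)) \<in> equitable q X (insert v V) \<rightarrow> (SIGMA A:?Q. equitable q (X - A) V)"
    proof
      fix c assume c: "c \<in> equitable q X (insert v V)"
      have "{x \<in> X - {x \<in> X. c x = v}. (if c x = v then 0 else c x) = u} = {x \<in> X. c x = u}" if "u \<in> V" for u
        using that insert.hyps by auto
      with c show "({x \<in> X. c x = v}, \<lambda>x. if c x = v then 0 else c x) \<in> (SIGMA A:?Q. equitable q (X - A) V)"
        by (auto simp: equitable_def)
    qed
    show "(\<lambda>c. ({x \<in> X. c x = v}, \<lambda>x. if c x = v then 0 else c x)) (case z of (A, c) \<Rightarrow> \<lambda>x. if x \<in> A then v else c x) = z"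
      if z: "z \<in> (SIGMA A:?Q. equitable q (X - A) V)" for z
    proof -
      obtain A c where zAc: "z = (A, c)" and A: "A \<subseteq> X" and c: "c \<in> equitable q (X - A) V"
        using z by auto
      have c0: "c x = 0" if "x \<notin> X - A" for x
        using c that by (auto simp: equitable_def)
      have cv: "c x \<noteq> v" if "x \<in> X - A" for x
        using c that insert.hyps by (auto simp: equitable_def)
      have "{x \<in> X. (if x \<in> A then v else c x) = v} = A"
        using A cv by auto
      moreover have "(if (if x \<in> A then v else c x) = v then 0 else if x \<in> A then v else c x) = c x" for x
        using c0 cv by auto
      ultimately show ?thesis unfolding zAc prod.case by simp
    qed
    show "(case ({x \<in> X. c x = v}, \<lambda>x. if c x = v then 0 else c x) of (A, c) \<Rightarrow> \<lambda>x. if x \<in> A then v else c x) = c"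
      if "c \<in> equitable q X (insert v V)" for c
      using that by (auto simp: equitable_def fun_eq_iff)
  qed
  then have "card (equitable q X (insert v V)) = (\<Sum>A\<in>?Q. card (equitable q (X - A) V))"
    using insert.prems fin by (simp add: bij_betw_same_card[symmetric])
  then have "card (equitable q X (insert v V)) * fact q ^ card (insert v V)
      = (\<Sum>A\<in>?Q. card (equitable q (X - A) V) * fact q ^ card V) * fact q"
    unfolding sum_distrib_right[symmetric] using insert.hyps by (simp add: mult_ac)
  also have "\<dots> = (card X choose q) * fact (card X - q) * fact q"
    using insert.prems by (simp add: IH n_subsets)
  also have "\<dots> = fact (card X)"
    using binomial_fact_lemma[of q "card X"] insert by (simp add: mult_ac)
  finally show ?case .
qed

text \<open>Translating all colours by \<open>v\<close> preserves equitability and exchanges the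
  values \<open>v\<close> and 0 at \<open>x0\<close>, so each value at \<open>x0\<close> is equally
  frequent.\<close>

lemma card_equitable_normalized:
  fixes V :: "('a \<Rightarrow> bit) set"
  assumes "finite V" "finite X" "card X = q * card V" "x0 \<in> X" "0 \<in> V" and add: "\<And>u v. u \<in> V \<Longrightarrow> v \<in> V \<Longrightarrow> u + v \<in> V"
  shows "card {c \<in> equitable q X V. c x0 = 0} * card V * fact q ^ card V = fact (card X)"
proof -
  let ?E = "equitable q X V"
  have "card ?E * fact q ^ card V > 0"
    using card_equitable[OF assms(1-3)] by simp
  then have finE: "finite ?E"
    by (intro card_ge_0_finite) simp
  have "card {c \<in> ?E. c x0 = v} = card {c \<in> ?E. c x0 = 0}" if v: "v \<in> V" for v
  proof (rule bij_betw_same_card[of "\<lambda>c x. if x \<in> X then c x + v else 0"])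
    have shift: "(\<lambda>x. if x \<in> X then c x + v else 0) \<in> ?E" if c: "c \<in> ?E" for c
    proof -
      have "{x \<in> X. (if x \<in> X then c x + v else 0) = u} = {x \<in> X. c x = u + v}" for u
        by auto
      then show ?thesis
        using c v add by (auto simp: equitable_def)
    qed
    have idem: "(\<lambda>x. if x \<in> X then (if x \<in> X then c x + v else 0) + v else 0) = c" if "c \<in> ?E" for c
      using that by (auto simp: equitable_def)
    show "bij_betw (\<lambda>c x. if x \<in> X then c x + v else 0) {c \<in> ?E. c x0 = v} {c \<in> ?E. c x0 = 0}"
      by (rule bij_betwI[where g = "\<lambda>c x. if x \<in> X then c x + v else 0"])
        (use shift idem \<open>x0 \<in> X\<close> in auto)
  qed
  moreover have "card ?E = (\<Sum>v\<in>V. card {c \<in> ?E. c x0 = v})"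
  proof -
    have "(\<Sum>v\<in>V. sum (\<lambda>_. 1::nat) {c \<in> ?E. c x0 = v}) = sum (\<lambda>_. 1) ?E"
      by (rule sum.group) (use finE assms in \<open>auto simp: equitable_def\<close>)
    then show ?thesis by simp
  qed
  ultimately have "card ?E = card {c \<in> ?E. c x0 = 0} * card V"
    by simp
  with card_equitable[OF assms(1-3)] show ?thesis by simp
qed

text \<open>Over GF(2) a linear combination is a subset sum. Entries from index \<open>j\<close> on
  are 0, so that a tuple is determined by its first \<open>j\<close> vectors.\<close>

definition independent_tuples :: "nat \<Rightarrow> ('a \<Rightarrow> bit) set \<Rightarrow> (nat \<Rightarrow> 'a \<Rightarrow> bit) set" where
  "independent_tuples j D = {r. (\<forall>s<j. r s \<in> D) \<and> (\<forall>s\<ge>j. r s = 0) \<and> (\<forall>A\<subseteq>{..<j}. A \<noteq> {} \<longrightarrow> sum r A \<noteq> 0)}"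

lemma sum_gf2_symdiff:
  fixes r :: "'b \<Rightarrow> 'a \<Rightarrow> bit"
  assumes "finite A" "finite B"
  shows "sum r A + sum r B = sum r ((A - B) \<union> (B - A))"
proof -
  have "sum r A = sum r (A \<inter> B) + sum r (A - B)" "sum r B = sum r (A \<inter> B) + sum r (B - A)"
    using sum.Int_Diff[OF assms(1), of r B] sum.Int_Diff[OF assms(2), of r A] by (simp_all add: Int_commute)
  then have "sum r A + sum r B = (sum r (A \<inter> B) + sum r (A \<inter> B)) + (sum r (A - B) + sum r (B - A))"
    by (simp only: ac_simps)
  also have "\<dots> = sum r ((A - B) \<union> (B - A))"
    using assms by (subst sum.union_disjoint) auto
  finally show ?thesis .
qed

text \<open>A further vector must avoid the 2^j subset sums of the earlier ones, which are distinct
  by independence and lie in \<open>D\<close>.\<close>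

lemma card_independent_tuples:
  assumes "finite D" "0 \<in> D" and add: "\<And>u v. u \<in> D \<Longrightarrow> v \<in> D \<Longrightarrow> u + v \<in> D"
  shows "card (independent_tuples j D) = (\<Prod>s<j. card D - 2 ^ s)"
proof -
  have "finite (independent_tuples j D) \<and> card (independent_tuples j D) = (\<Prod>s<j. card D - 2 ^ s)"
  proof (induction j)
    case 0
    have "independent_tuples 0 D = {\<lambda>_. 0}"
      by (auto simp: independent_tuples_def)
    then show ?case by simp
  next
    case (Suc j)
    let ?span = "\<lambda>r. sum r ` Pow {..<j}"
    have sub: "?span r \<subseteq> D" if "r \<in> independent_tuples j D" for r
    proof -
      have "sum r A \<in> D" if "A \<subseteq> {..<j}" for A
        using finite_subset[OF that finite_lessThan] that
        by (induction A) (use \<open>r \<in> _\<close> assms in \<open>auto simp: independent_tuples_def\<close>)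
      then show ?thesis by auto
    qed
    have card_span: "card (?span r) = 2 ^ j" if r: "r \<in> independent_tuples j D" for r
    proof -
      have "inj_on (sum r) (Pow {..<j})"
      proof (rule inj_onI)
        fix A B assume AB: "A \<in> Pow {..<j}" "B \<in> Pow {..<j}" "sum r A = sum r B"
        then have "finite A" "finite B" by (auto intro: finite_subset)
        then have "sum r ((A - B) \<union> (B - A)) = 0"
          using AB(3) by (simp only: sum_gf2_symdiff[symmetric] gf2_vec_add_self)
        moreover have "(A - B) \<union> (B - A) \<subseteq> {..<j}" using AB by auto
        ultimately have "(A - B) \<union> (B - A) = {}"
          using r unfolding independent_tuples_def by blast
        then show "A = B" by blast
      qed
      then show ?thesis by (simp add: card_image card_Pow)
    qed
    have upd: "r(j := v) \<in> independent_tuples (Suc j) D \<longleftrightarrow> v \<in> D - ?span r"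
      if r: "r \<in> independent_tuples j D" for r v
    proof -
      have sum_upd: "sum (r(j := v)) A = sum r A" if "A \<subseteq> {..<j}" for A
        using that by (intro sum.cong) auto
      have "(\<forall>A\<subseteq>{..<Suc j}. A \<noteq> {} \<longrightarrow> sum (r(j := v)) A \<noteq> 0) \<longleftrightarrow> v \<notin> ?span r"
      proof
        assume *: "\<forall>A\<subseteq>{..<Suc j}. A \<noteq> {} \<longrightarrow> sum (r(j := v)) A \<noteq> 0"
        show "v \<notin> ?span r"
        proof
          assume "v \<in> ?span r"
          then obtain A where A: "A \<subseteq> {..<j}" "v = sum r A" by auto
          then have "finite A" "j \<notin> A" by (auto intro: finite_subset)
          then have "sum (r(j := v)) (insert j A) = v + sum r A"
            using sum_upd[OF A(1)] by simp
          then have "sum (r(j := v)) (insert j A) = 0"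
            using A(2) by simp
          moreover have "insert j A \<subseteq> {..<Suc j}" using A by auto
          ultimately show False using * by blast
        qed
      next
        assume *: "v \<notin> ?span r"
        show "\<forall>A\<subseteq>{..<Suc j}. A \<noteq> {} \<longrightarrow> sum (r(j := v)) A \<noteq> 0"
        proof (intro allI impI)
          fix A assume A: "A \<subseteq> {..<Suc j}" "A \<noteq> {}"
          show "sum (r(j := v)) A \<noteq> 0"
          proof (cases "j \<in> A")
            case False
            then have "A \<subseteq> {..<j}" using A by (auto simp: less_Suc_eq)
            then show ?thesis
              using r A(2) sum_upd by (auto simp: independent_tuples_def)
          next
            case True
            have Aj: "A - {j} \<subseteq> {..<j}" using A by (auto simp: less_Suc_eq)
            have "finite A" using A(1) by (rule finite_subset) simp
            then have "sum (r(j := v)) A = v + sum r (A - {j})"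
              using True sum_upd[OF Aj] by (simp add: sum.remove)
            moreover have "v \<noteq> sum r (A - {j})" using * Aj by blast
            ultimately show ?thesis by (simp only: gf2_vec_add_eq_0_iff not_False_eq_True)
          qed
        qed
      qed
      then show ?thesis
        using r by (auto simp: independent_tuples_def less_Suc_eq)
    qed
    have bij: "bij_betw (\<lambda>(r, v). r(j := v)) (SIGMA r:independent_tuples j D. D - ?span r) (independent_tuples (Suc j) D)"
    proof (rule bij_betwI[where g = "\<lambda>r. (r(j := 0), r j)"])
      show "(\<lambda>(r, v). r(j := v)) \<in> (SIGMA r:independent_tuples j D. D - ?span r) \<rightarrow> independent_tuples (Suc j) D"
        by (intro funcsetI) (clarsimp simp: upd)
      show "(\<lambda>r. (r(j := 0), r j)) \<in> independent_tuples (Suc j) D \<rightarrow> (SIGMA r:independent_tuples j D. D - ?span r)"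
      proof
        fix r assume r: "r \<in> independent_tuples (Suc j) D"
        have "sum (r(j := 0)) A \<noteq> 0" if "A \<subseteq> {..<j}" "A \<noteq> {}" for A
        proof -
          have "sum (r(j := 0)) A = sum r A"
            using that by (intro sum.cong) auto
          moreover have "A \<subseteq> {..<Suc j}" using that by auto
          ultimately show ?thesis
            using r that(2) by (auto simp: independent_tuples_def)
        qed
        then have "r(j := 0) \<in> independent_tuples j D"
          using r by (auto simp: independent_tuples_def)
        with upd[OF this, of "r j"] r show "(r(j := 0), r j) \<in> (SIGMA r:independent_tuples j D. D - ?span r)"
          by simp
      qed
    qed (auto simp: independent_tuples_def fun_eq_iff)
    have "card (independent_tuples (Suc j) D) = (\<Sum>r\<in>independent_tuples j D. card (D - ?span r))"
      using Suc.IH \<open>finite D\<close> by (simp add: bij_betw_same_card[OF bij, symmetric])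
    also have "\<dots> = (\<Sum>r\<in>independent_tuples j D. card D - 2 ^ j)"
      by (rule sum.cong) (use sub card_span in \<open>auto simp: card_Diff_subset\<close>)
    finally have "card (independent_tuples (Suc j) D) = (\<Prod>s<Suc j. card D - 2 ^ s)"
      using Suc.IH by simp
    moreover have "finite (independent_tuples (Suc j) D)"
      using bij_betw_finite[OF bij] Suc.IH \<open>finite D\<close> by auto
    ultimately show ?case by simp
  qed
  then show ?thesis ..
qed

section \<open>The dual code of a Steiner triple system\<close>

definition dual :: "nat \<Rightarrow> nat set set \<Rightarrow> (nat \<Rightarrow> bit) set" where
  "dual n S = {v \<in> vecs {1..n}. \<forall>b\<in>S. sum v b = 0}"

lemma dual_add: "u \<in> dual n S \<Longrightarrow> v \<in> dual n S \<Longrightarrow> u + v \<in> dual n S"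
  by (auto simp: dual_def vecs_def sum.distrib)

lemma dual_0: "0 \<in> dual n S"
  by (auto simp: dual_def vecs_def)

lemma finite_dual: "finite (dual n S)"
  by (rule finite_subset[OF _ finite_vecs[of "{1..n}"]]) (auto simp: dual_def)

text \<open>Orthogonality to the blocks extends to their span, so the dual code is the annihilator
  of a space of dimension \<open>rank2 S\<close>.\<close>

lemma card_dual:
  assumes "\<And>b. b \<in> S \<Longrightarrow> b \<subseteq> {1..n}"
  shows "2 ^ rank2 S * card (dual n S) = 2 ^ n"
proof -
  let ?X = "{1..n}" and ?W = "gf2.span (char_vec ` S)"
  have sub: "gf2.subspace (vecs ?X)"
    by (auto simp: gf2.subspace_def vecs_def gf2_scale_def)
  have W: "?W \<subseteq> vecs ?X"
  proof (rule gf2.span_minimal[OF _ sub], rule image_subsetI)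
    fix b assume "b \<in> S"
    from assms[OF this] show "char_vec b \<in> vecs ?X"
      unfolding vecs_def char_vec_def by auto
  qed
  then have fin: "finite ?W"
    using finite_vecs[of ?X] finite_subset by blast
  have gen: "(\<Sum>x\<in>?X. char_vec b x * v x) = sum v b" if "b \<in> S" for b v
  proof -
    have "(\<Sum>x\<in>?X. char_vec b x * v x) = (\<Sum>x\<in>?X. if x \<in> b then v x else 0)"
      by (rule sum.cong) (auto simp: char_vec_def)
    also have "\<dots> = sum v (?X \<inter> b)"
      by (simp add: sum.inter_restrict)
    also have "?X \<inter> b = b" using assms[OF that] by auto
    finally show ?thesis .
  qed
  have perp: "(\<Sum>x\<in>?X. u x * v x) = 0" if "u \<in> ?W" and v: "\<And>b. b \<in> S \<Longrightarrow> sum v b = 0" for u v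
    using that(1)
  proof (induction rule: gf2.span_induct)
    case base
    show ?case
      by (auto simp: gf2.subspace_def gf2_scale_def distrib_right sum.distrib mult.assoc simp flip: sum_distrib_left)
  next
    case (step u)
    then show ?case using gen v by auto
  qed
  have "ann ?X ?W = dual n S"
  proof (intro subset_antisym subsetI)
    fix v assume v: "v \<in> ann ?X ?W"
    have "sum v b = 0" if "b \<in> S" for b
      unfolding gen[OF that, symmetric] using v gf2.span_base[of "char_vec b" "char_vec ` S"] that
      by (simp add: ann_def)
    with v show "v \<in> dual n S" by (simp add: ann_def dual_def)
  next
    fix v assume "v \<in> dual n S"
    with perp show "v \<in> ann ?X ?W" by (simp add: ann_def dual_def)
  qed
  with card_ann[of ?X ?W] W show ?thesis
    by (simp add: gf2.span_zero gf2.span_add card_gf2_span[OF fin] rank2_def)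
qed

text \<open>Fix a point \<open>a\<close> with v a = 1. In a block {a, y, z} the values sum to 0, so
  \<open>v\<close> differs at \<open>y\<close> and \<open>z\<close>: the blocks through
  \<open>a\<close> pair off the other points with opposite signs.\<close>

lemma dual_balanced:
  assumes S: "is_STS n S" and v: "v \<in> dual n S" "v \<noteq> 0"
  shows "(\<Sum>x\<le>n. sgn2 (v x)) = 0"
proof -
  have "\<exists>a. v a = 1"
  proof (rule ccontr)
    assume "\<not> ?thesis"
    then have "v = 0" by (auto simp: fun_eq_iff)
    with v show False by simp
  qed
  then obtain a where a: "v a = 1" ..
  have v0: "v x = 0" if "x \<notin> {1..n}" for x
    using v that unfolding dual_def vecs_def by blast
  with a have aX: "a \<in> {1..n}" by force
  then have "a \<noteq> 0" by simp
  have blocks: "b \<subseteq> {1..n}" "card b = 3" "sum v b = 0" if "b \<in> S" for b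
    using S v that by (auto simp: is_STS_def dual_def)
  have uniq: "\<exists>!b. b \<in> S \<and> {a, y} \<subseteq> b" if "y \<in> {1..n} - {a}" for y
  proof -
    have "{a, y} \<subseteq> {1..n} \<and> card {a, y} = 2"
      using that aX by auto
    moreover have "\<forall>p. p \<subseteq> {1..n} \<and> card p = 2 \<longrightarrow> (\<exists>!b. b \<in> S \<and> p \<subseteq> b)"
      using S by (simp add: is_STS_def)
    ultimately show ?thesis by (elim allE[of _ "{a, y}"] mp)
  qed
  have "\<forall>y\<in>{1..n} - {a}. \<exists>z. z \<in> {1..n} - {a} \<and> z \<noteq> y \<and> {a, y, z} \<in> S"
  proof
    fix y assume y: "y \<in> {1..n} - {a}"
    then obtain b where b: "b \<in> S" "{a, y} \<subseteq> b" using uniq[OF y] by blast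
    have "card (b - {a, y}) = 1"
      using blocks[OF b(1)] b(2) y by (subst card_Diff_subset) auto
    then obtain z where z: "b - {a, y} = {z}"
      by (auto simp: card_1_singleton_iff)
    then have "b = {a, y, z}" "z \<noteq> a" "z \<noteq> y" using b by auto
    then show "\<exists>z. z \<in> {1..n} - {a} \<and> z \<noteq> y \<and> {a, y, z} \<in> S"
      using b blocks[OF b(1)] by auto
  qed
  then obtain t where t: "\<And>y. y \<in> {1..n} - {a} \<Longrightarrow> t y \<in> {1..n} - {a}"
      "\<And>y. y \<in> {1..n} - {a} \<Longrightarrow> t y \<noteq> y" "\<And>y. y \<in> {1..n} - {a} \<Longrightarrow> {a, y, t y} \<in> S"
    by (metis bchoice)
  have tt: "t (t y) = y" if y: "y \<in> {1..n} - {a}" for y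
  proof -
    have "{a, y, t y} = {a, t y, t (t y)}"
      using uniq[OF t(1)[OF y]] t(3)[OF y] t(3)[OF t(1)[OF y]] by blast
    then show ?thesis
      using y t(2)[OF y] by auto
  qed
  have vt: "v (t y) = v y + 1" if y: "y \<in> {1..n} - {a}" for y
  proof -
    have "v a + (v y + v (t y)) = 0"
      using blocks(3)[OF t(3)[OF y]] t(1,2)[OF y] y by auto
    then show ?thesis
      using a by (cases "v y"; cases "v (t y)") auto
  qed
  \<comment> \<open>The extra point 0, where \<open>v\<close> is 0, is the partner that
    \<open>a\<close> lacks; this is why the sum runs over n + 1 points.\<close>
  define \<sigma> where "\<sigma> y = (if y = 0 then a else if y = a then 0 else t y)" for y
  have \<sigma>: "\<sigma> y \<in> {..n}" "\<sigma> (\<sigma> y) = y" "v (\<sigma> y) = v y + 1" if y: "y \<in> {..n}" for y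
  proof -
    consider "y = 0" | "y = a" | "y \<in> {1..n} - {a}" "y \<noteq> 0" "y \<noteq> a"
      using y by force
    then have "\<sigma> y \<in> {..n} \<and> \<sigma> (\<sigma> y) = y \<and> v (\<sigma> y) = v y + 1"
    proof cases
      case 1
      then show ?thesis using a aX \<open>a \<noteq> 0\<close> v0[of 0] by (simp add: \<sigma>_def)
    next
      case 2
      then show ?thesis using a aX \<open>a \<noteq> 0\<close> v0[of 0] by (simp add: \<sigma>_def)
    next
      case 3
      then have "t y \<noteq> 0" "t y \<noteq> a" "t y \<le> n" using t(1)[OF 3(1)] by auto
      with 3 show ?thesis by (simp add: \<sigma>_def tt vt)
    qed
    then show "\<sigma> y \<in> {..n}" "\<sigma> (\<sigma> y) = y" "v (\<sigma> y) = v y + 1" by auto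
  qed
  have "(\<Sum>x\<le>n. sgn2 (v x)) = (\<Sum>x\<le>n. sgn2 (v (\<sigma> x)))"
    by (rule sum.reindex_bij_witness[of _ \<sigma> \<sigma>]) (use \<sigma>(1,2) in auto)
  also have "\<dots> = (\<Sum>x\<le>n. - sgn2 (v x))"
    by (rule sum.cong) (auto simp: \<sigma>(3) sgn2_add)
  finally show ?thesis by (simp add: sum_negf)
qed

section \<open>Tuples of dual vectors as colourings\<close>

definition flip_args :: "('a \<Rightarrow> 'b \<Rightarrow> 'c) \<Rightarrow> 'b \<Rightarrow> 'a \<Rightarrow> 'c" where
  "flip_args r = (\<lambda>x s. r s x)"

text \<open>Pairing the colour of \<open>x\<close> with \<open>a\<close> evaluates a combination of
  the rows at \<open>x\<close>, so a character sum over colours is a sign sum of one dual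
  vector.\<close>

lemma sum_rows_apply:
  fixes r :: "'b \<Rightarrow> 'a \<Rightarrow> bit"
  assumes "finite X"
  shows "sum r {s \<in> X. a s = 1} x = (\<Sum>s\<in>X. flip_args r x s * a s)"
proof -
  have "(\<Sum>s\<in>X. flip_args r x s * a s) = (\<Sum>s\<in>X. if a s = 1 then r s x else 0)"
  proof (rule sum.cong)
    show "flip_args r x s * a s = (if a s = 1 then r s x else 0)" for s
      by (cases "a s") (auto simp: flip_args_def)
  qed simp
  also have "\<dots> = (\<Sum>s\<in>{s \<in> X. a s = 1}. r s x)"
    using assms by (simp add: sum.inter_filter)
  finally show ?thesis by (simp add: sum_fun_apply)
qed

text \<open>Every nontrivial character of the colour space corresponds to a nonzero combination of
  the tuple, which is balanced. Only the trivial character contributes, giving n + 1 for every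
  colour.\<close>

lemma independent_tuple_fiber:
  assumes S: "is_STS n S" and r: "r \<in> independent_tuples j (dual n S)" and v: "v \<in> vecs {..<j}"
  shows "2 ^ j * card {x \<in> {..n}. flip_args r x = v} = Suc n"
proof -
  let ?V = "vecs {..<j}"
  let ?c = "flip_args r"
  let ?ip = "\<lambda>u a. \<Sum>s<j. u s * a s :: bit"
  have c: "?c x \<in> ?V" for x
    using r by (auto simp: flip_args_def vecs_def independent_tuples_def)
  have zero: "0 \<in> ?V" by (rule vecs_0)
  have *: "(\<Sum>x\<le>n. sgn2 (?ip (?c x) a)) = 0" if a: "a \<in> ?V" "a \<noteq> 0" for a
  proof -
    let ?A = "{s \<in> {..<j}. a s = 1}"
    have "?A \<noteq> {}"
    proof
      assume "?A = {}"
      then have "a s = 0" for s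
        using a(1) by (cases "s < j") (auto simp: vecs_def)
      with a(2) show False by (auto simp: fun_eq_iff)
    qed
    moreover have "\<forall>A\<subseteq>{..<j}. A \<noteq> {} \<longrightarrow> sum r A \<noteq> 0"
      using r by (simp add: independent_tuples_def)
    ultimately have ne: "sum r ?A \<noteq> 0"
      by (elim allE[of _ ?A]) auto
    have span: "sum r B \<in> dual n S" if "finite B" "B \<subseteq> {..<j}" for B
      using that by (induction B) (use r in \<open>auto simp: independent_tuples_def dual_0 dual_add\<close>)
    have "sum r ?A \<in> dual n S"
      by (rule span) (simp_all add: subset_eq)
    from dual_balanced[OF S this ne] have "(\<Sum>x\<le>n. sgn2 (sum r ?A x)) = 0" .
    then show ?thesis by (simp only: sum_rows_apply[OF finite_lessThan])
  qed
  have "real (2 ^ j * card {x \<in> {..n}. ?c x = v}) = (\<Sum>x\<le>n. if ?c x = v then 2 ^ j else 0)"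
    by (simp flip: sum.inter_filter)
  \<comment> \<open>The indicator of colour \<open>v\<close>, scaled by 2^j, is the sum of all
    characters at \<open>?c x + v\<close>.\<close>
  also have "\<dots> = (\<Sum>x\<le>n. \<Sum>a\<in>?V. sgn2 (?ip (?c x + v) a))"
    by (intro sum.cong refl, subst sum_sgn2_vecs) (simp_all add: vecs_add c v gf2_vec_add_eq_0_iff del: plus_fun_apply)
  also have "\<dots> = (\<Sum>a\<in>?V. sgn2 (?ip v a) * (\<Sum>x\<le>n. sgn2 (?ip (?c x) a)))"
    by (subst sum.swap) (simp only: plus_fun_apply distrib_right sum.distrib sgn2_add sum_distrib_left mult.commute[of "sgn2 (?ip v _)"])
  also have "\<dots> = (\<Sum>a\<in>?V. if a = 0 then real (Suc n) else 0)"
    by (rule sum.cong) (auto simp: *)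
  also have "\<dots> = Suc n"
    using zero finite_vecs[of "{..<j}"] by simp
  finally show ?thesis by linarith
qed

text \<open>Transposition is its own inverse. One direction is the fibre count; in the other,
  equitability with q > 0 makes every colour occur, which rules out linear relations.\<close>

lemma bij_betw_flip_args_compatible:
  assumes S: "is_STS n S" and w: "Suc n = q * 2 ^ j"
  shows "bij_betw flip_args (independent_tuples j (dual n S))
    {c \<in> equitable q {..n} (vecs {..<j}). c 0 = 0 \<and> (\<forall>b\<in>S. sum c b = 0)}"
proof (rule bij_betwI[where g = flip_args])
  have "q > 0" using w by (cases q) auto
  have rows: "(\<forall>b\<in>S. sum (flip_args r) b = 0) \<longleftrightarrow> (\<forall>s. \<forall>b\<in>S. sum (r s) b = 0)" for r :: "nat \<Rightarrow> nat \<Rightarrow> bit"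
    by (auto simp: fun_eq_iff[of "sum _ _"] sum_fun_apply flip_args_def)
  show "flip_args \<in> independent_tuples j (dual n S) \<rightarrow>
      {c \<in> equitable q {..n} (vecs {..<j}). c 0 = 0 \<and> (\<forall>b\<in>S. sum c b = 0)}"
  proof
    fix r assume r: "r \<in> independent_tuples j (dual n S)"
    have rs: "r s \<in> dual n S" for s
      using r dual_0 by (cases "s < j") (auto simp: independent_tuples_def)
    have "card {x \<in> {..n}. flip_args r x = v} = q" if "v \<in> vecs {..<j}" for v
      using independent_tuple_fiber[OF S r that] w by simp
    moreover have "flip_args r x = 0" if "x \<notin> {1..n}" for x
      using rs that by (auto simp: flip_args_def dual_def vecs_def fun_eq_iff)
    moreover have "flip_args r x \<in> vecs {..<j}" for x
      using r by (auto simp: flip_args_def vecs_def independent_tuples_def)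
    moreover have "\<forall>b\<in>S. sum (flip_args r) b = 0"
      unfolding rows using rs by (auto simp: dual_def)
    ultimately show "flip_args r \<in> {c \<in> equitable q {..n} (vecs {..<j}). c 0 = 0 \<and> (\<forall>b\<in>S. sum c b = 0)}"
      by (auto simp: equitable_def)
  qed
  show "flip_args \<in> {c \<in> equitable q {..n} (vecs {..<j}). c 0 = 0 \<and> (\<forall>b\<in>S. sum c b = 0)} \<rightarrow>
      independent_tuples j (dual n S)"
  proof
    fix c assume c: "c \<in> {c \<in> equitable q {..n} (vecs {..<j}). c 0 = 0 \<and> (\<forall>b\<in>S. sum c b = 0)}"
    have cV: "c x \<in> vecs {..<j}" for x
      using c by (cases "x \<le> n") (auto simp: equitable_def vecs_0)
    have c0: "c x = 0" if "x \<notin> {1..n}" for x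
      using c that by (cases "x = 0") (auto simp: equitable_def)
    have "\<forall>b\<in>S. sum (flip_args (flip_args c)) b = 0"
      using c by (simp add: flip_args_def)
    then have "flip_args c s \<in> dual n S" for s
      unfolding rows using c0 by (auto simp: dual_def vecs_def flip_args_def)
    moreover have "flip_args c s = 0" if "s \<ge> j" for s
      using cV that by (auto simp: flip_args_def vecs_def fun_eq_iff)
    moreover have "sum (flip_args c) A \<noteq> 0" if A: "A \<subseteq> {..<j}" "A \<noteq> {}" for A
    proof -
      from A(2) obtain s0 where s0: "s0 \<in> A" by blast
      \<comment> \<open>At a point whose colour is this unit vector, exactly one summand over
        \<open>A\<close> is 1.\<close>
      define e :: "nat \<Rightarrow> bit" where "e = (\<lambda>s. if s = s0 then 1 else 0)"
      have "e \<in> vecs {..<j}" using A s0 by (auto simp: e_def vecs_def)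
      then have "card {x \<in> {..n}. c x = e} = q"
        using c by (auto simp: equitable_def)
      then have "{x \<in> {..n}. c x = e} \<noteq> {}"
        using \<open>q > 0\<close> by (metis card.empty less_irrefl)
      then obtain x where "c x = e" by blast
      then have "sum (flip_args c) A x = (\<Sum>s\<in>A. e s)"
        by (simp add: sum_fun_apply flip_args_def)
      also have "\<dots> = 1"
        using s0 finite_subset[OF A(1)] by (simp add: e_def)
      finally show ?thesis by (auto simp: fun_eq_iff)
    qed
    ultimately show "flip_args c \<in> independent_tuples j (dual n S)"
      by (auto simp: independent_tuples_def)
  qed
qed (simp_all add: flip_args_def)

lemma finite_STS: "finite {S. is_STS n S}"
  by (rule finite_subset[of _ "Pow (Pow {1..n})"]) (auto simp: is_STS_def)

text \<open>Pairs of a system and a compatible colouring are counted from both sides; the number of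
  systems is the same for every normalised equitable colouring.\<close>

lemma sum_card_independent_tuples:
  assumes w: "Suc n = q * 2 ^ j"
  shows "(\<Sum>S | is_STS n S. card (independent_tuples j (dual n S)))
    = card {c \<in> equitable q {..n} (vecs {..<j}). c 0 = 0}
      * (Psi (q - 1) * Defs.Pi (q - 1) ^ (2 ^ j - 1) * Lambda q ^ ((2 ^ j - 1) * (2 ^ j - 2) div 6))"
proof -
  let ?V = "vecs {..<j}"
  let ?E = "{c \<in> equitable q {..n} ?V. c 0 = 0}"
  let ?\<Phi> = "Psi (q - 1) * Defs.Pi (q - 1) ^ (2 ^ j - 1) * Lambda q ^ ((2 ^ j - 1) * (2 ^ j - 2) div 6)"
  have "q > 0" using w by (cases q) auto
  have V: "finite ?V" "card ?V = 2 ^ j"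
    by (simp_all add: finite_vecs card_vecs)
  have "card ?E * card ?V * fact q ^ card ?V = fact (card {..n})"
    by (rule card_equitable_normalized) (use V w in \<open>simp_all add: vecs_0 vecs_add\<close>)
  then have "card ?E \<noteq> 0" by (intro notI) simp
  then have finE: "finite ?E" by (intro card_ge_0_finite) simp
  have fiber: "card {S. is_STS n S \<and> (\<forall>b\<in>S. sum c b = 0)} = ?\<Phi>" if c: "c \<in> ?E" for c
  proof -
    have "card {x \<in> {1..n}. c x = v} = (if v = 0 then q - 1 else q)" if v: "v \<in> ?V" for v
    proof -
      have "card {x \<in> {..n}. c x = v} = q"
        using c v by (auto simp: equitable_def)
      moreover have "{x \<in> {..n}. c x = v} = (if v = 0 then insert 0 {x \<in> {1..n}. c x = v} else {x \<in> {1..n}. c x = v})"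
      proof -
        have "{..n} = insert 0 {1..n}" by auto
        then show ?thesis using c by auto
      qed
      ultimately show ?thesis by (auto split: if_splits)
    qed
    moreover have "c x \<in> ?V" if "x \<in> {1..n}" for x
      using c that by (auto simp: equitable_def)
    ultimately show ?thesis
      using card_coloured_systems[of "{1..n}" ?V c q] V \<open>q > 0\<close>
      by (simp add: is_STS_iff_exact vecs_0 vecs_add)
  qed
  have "(\<Sum>S | is_STS n S. card (independent_tuples j (dual n S)))
      = (\<Sum>S | is_STS n S. \<Sum>c\<in>?E. if \<forall>b\<in>S. sum c b = 0 then 1 else 0)"
  proof (rule sum.cong)
    fix S assume "S \<in> {S. is_STS n S}"
    then have "card (independent_tuples j (dual n S)) = card {c \<in> equitable q {..n} ?V. c 0 = 0 \<and> (\<forall>b\<in>S. sum c b = 0)}"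
      using bij_betw_same_card[OF bij_betw_flip_args_compatible[OF _ w]] by simp
    also have "\<dots> = card {c \<in> ?E. \<forall>b\<in>S. sum c b = 0}"
      by (rule arg_cong[of _ _ card]) auto
    also have "\<dots> = (\<Sum>c\<in>?E. if \<forall>b\<in>S. sum c b = 0 then 1 else 0)"
      using sum.inter_filter[OF finE, of "\<lambda>_. 1::nat" "\<lambda>c. \<forall>b\<in>S. sum c b = 0"] by simp
    finally show "card (independent_tuples j (dual n S)) = \<dots>" .
  qed simp
  also have "\<dots> = (\<Sum>c\<in>?E. card {S. is_STS n S \<and> (\<forall>b\<in>S. sum c b = 0)})"
  proof (subst sum.swap, rule sum.cong)
    fix c
    show "(\<Sum>S | is_STS n S. if \<forall>b\<in>S. sum c b = 0 then 1 else 0) = card {S. is_STS n S \<and> (\<forall>b\<in>S. sum c b = 0)}"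
      using sum.inter_filter[OF finite_STS[of n], of "\<lambda>_. 1::nat" "\<lambda>S. \<forall>b\<in>S. sum c b = 0"] by simp
  qed simp
  also have "\<dots> = card ?E * ?\<Phi>"
    using fiber by simp
  finally show ?thesis .
qed

text \<open>For the divisibility, a dual code of dimension m contains an independent m-tuple, whose
  2^m colour classes partition n + 1 points equally.\<close>

lemma rank2_STS:
  assumes S: "is_STS n S"
  shows "rank2 S \<le> n" "card (dual n S) = 2 ^ (n - rank2 S)" "2 ^ (n - rank2 S) dvd Suc n"
proof -
  have eq: "2 ^ rank2 S * card (dual n S) = 2 ^ n"
    using card_dual S by (simp add: is_STS_def)
  then have "(2::nat) ^ rank2 S dvd 2 ^ n" by (metis dvd_triv_left)
  then show le: "rank2 S \<le> n" by (simp add: dvd_power_iff_le)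
  have "(2::nat) ^ n = 2 ^ rank2 S * 2 ^ (n - rank2 S)"
    using le by (simp flip: power_add)
  with eq show card: "card (dual n S) = 2 ^ (n - rank2 S)" by simp
  let ?m = "n - rank2 S"
  have "card (independent_tuples ?m (dual n S)) = (\<Prod>s<?m. 2 ^ ?m - 2 ^ s)"
    using card_independent_tuples[OF finite_dual dual_0 dual_add] card by simp
  also have "\<dots> > 0"
    by (rule prod_pos) simp
  finally have "independent_tuples ?m (dual n S) \<noteq> {}"
    by (metis card.empty less_irrefl)
  then obtain r where "r \<in> independent_tuples ?m (dual n S)" by blast
  from independent_tuple_fiber[OF S this vecs_0] show "2 ^ ?m dvd Suc n"
    by (metis dvd_triv_left)
qed

theorem theorem2:
  fixes w i :: nat
  assumes "(w - 1) mod 6 = 1 \<or> (w - 1) mod 6 = 3"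
    and "i \<le> multiplicity (2::nat) w"
  shows "real (card {B. is_STS (w - 1) B \<and> rank2 B = w - i - 1}) =
    GammaDot w 0 i * (\<Sum>j::nat \<in> {i..multiplicity (2::nat) w}. GammaDot w i j * mu2 (j - i) * PhiDot w j)"
proof -
  define n where "n = w - 1"
  \<comment> \<open>For w = 0 the truncated w - 1 would be 0, which has neither residue.\<close>
  have w: "w = Suc n" using assms(1) by (cases w) (auto simp: n_def)
  define k where "k = multiplicity (2::nat) w"
  have dvd_iff: "2 ^ j dvd w \<longleftrightarrow> j \<le> k" for j
    unfolding k_def using w by (intro power_dvd_iff_le_multiplicity) auto
  define a where "a m = real (card {S. is_STS n S \<and> n - rank2 S = m})" for m
  define E where "E j = {c \<in> equitable (w div 2 ^ j) {..n} (vecs {..<j}). c 0 = 0}" for j :: nat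
  have E: "real (card (E j)) * 2 ^ j * fact (w div 2 ^ j) ^ 2 ^ j = fact w" if "j \<le> k" for j
  proof -
    have "w = w div 2 ^ j * 2 ^ j" using that by (simp add: dvd_iff)
    then have "card (E j) * card (vecs {..<j}) * fact (w div 2 ^ j) ^ card (vecs {..<j}) = fact (card {..n})"
      unfolding E_def
      by (intro card_equitable_normalized) (simp_all add: finite_vecs card_vecs vecs_0 vecs_add w)
    then have "real (card (E j) * 2 ^ j * fact (w div 2 ^ j) ^ 2 ^ j) = real (fact w)"
      by (simp add: card_vecs w)
    then show ?thesis by (simp add: of_nat_power)
  qed
  have F: "real (card (E j)) * PhiDot w j = (\<Sum>m\<le>k. a m * (\<Prod>s<j. 2 ^ m - 2 ^ s))" if j: "j \<le> k" for j
  proof -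
    have wq: "Suc n = w div 2 ^ j * 2 ^ j" using j dvd_iff[of j] by (simp flip: w)
    \<comment> \<open>The products over naturals and over reals subtract differently once
      \<open>j\<close> exceeds the dual dimension, but the factor at s = n - rank2 S makes both
      0.\<close>
    have tuples: "real (card (independent_tuples j (dual n S))) = (\<Prod>s<j. 2 ^ (n - rank2 S) - 2 ^ s)"
      if S: "is_STS n S" for S
    proof (cases "j \<le> n - rank2 S")
      case True
      then have "real (\<Prod>s<j. 2 ^ (n - rank2 S) - 2 ^ s) = (\<Prod>s<j. 2 ^ (n - rank2 S) - 2 ^ s)"
        unfolding of_nat_prod by (intro prod.cong refl) (simp add: of_nat_diff)
      then show ?thesis
        using card_independent_tuples[where D = "dual n S", OF finite_dual dual_0 dual_add] rank2_STS(2)[OF S] by simp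
    next
      case False
      then have "(\<Prod>s<j. (2::nat) ^ (n - rank2 S) - 2 ^ s) = 0"
        by (intro prod_zero) auto
      then show ?thesis
        using card_independent_tuples[where D = "dual n S", OF finite_dual dual_0 dual_add] rank2_STS(2)[OF S] False
        by (simp add: prod_pow2_diff_eq_0)
    qed
    have "real (card (E j)) * PhiDot w j = real (\<Sum>S | is_STS n S. card (independent_tuples j (dual n S)))"
      unfolding sum_card_independent_tuples[OF wq] PhiDot_def E_def by simp
    also have "\<dots> = (\<Sum>S | is_STS n S. \<Prod>s<j. 2 ^ (n - rank2 S) - 2 ^ s)"
      by (simp add: tuples)
    also have "\<dots> = (\<Sum>m\<le>k. \<Sum>S\<in>{S \<in> {S. is_STS n S}. n - rank2 S = m}. \<Prod>s<j. 2 ^ (n - rank2 S) - 2 ^ s)"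
    proof (rule sum.group[symmetric])
      show "(\<lambda>S. n - rank2 S) ` {S. is_STS n S} \<subseteq> {..k}"
        using rank2_STS(3) dvd_iff w by auto
    qed (simp_all add: finite_STS)
    also have "\<dots> = (\<Sum>m\<le>k. a m * (\<Prod>s<j. 2 ^ m - 2 ^ s))"
      by (simp add: a_def)
    finally show ?thesis .
  qed
  have i: "i \<le> k" using assms(2) by (simp add: k_def)
  have "2 ^ i \<le> w" using i dvd_iff[of i] w by (intro dvd_imp_le) auto
  \<comment> \<open>Keeps w - i - 1 from being truncated, so that this rank means dual dimension
    \<open>i\<close>.\<close>
  then have "i \<le> n" using less_exp[of i] w by linarith
  then have "{B. is_STS (w - 1) B \<and> rank2 B = w - i - 1} = {S. is_STS n S \<and> n - rank2 S = i}"
    using rank2_STS(1) w by auto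
  then have "real (card {B. is_STS (w - 1) B \<and> rank2 B = w - i - 1}) = a i"
    by (simp add: a_def)
  also have "\<dots> = (\<Sum>j = i..k. mu2 (j - i) * (real (card (E j)) * PhiDot w j) / (2 ^ (j choose 2) * qfact i * qfact (j - i)))"
    using gauss_inversion[OF F i] .
  also have "\<dots> = (\<Sum>j = i..k. GammaDot w 0 i * (GammaDot w i j * mu2 (j - i) * PhiDot w j))"
  proof (rule sum.cong)
    fix j assume j: "j \<in> {i..k}"
    then have "GammaDot w 0 i * GammaDot w i j = real (card (E j)) / (2 ^ (j choose 2) * qfact i * qfact (j - i))"
      using E[of j] by (simp add: GammaDot_mult divide_simps)
    then show "mu2 (j - i) * (real (card (E j)) * PhiDot w j) / (2 ^ (j choose 2) * qfact i * qfact (j - i))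
        = GammaDot w 0 i * (GammaDot w i j * mu2 (j - i) * PhiDot w j)"
      by (simp add: mult.assoc[symmetric])
  qed simp
  also have "\<dots> = GammaDot w 0 i * (\<Sum>j::nat \<in> {i..k}. GammaDot w i j * mu2 (j - i) * PhiDot w j)"
    by (simp add: sum_distrib_left)
  finally show ?thesis unfolding k_def .
qed

end
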